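(* Consider the carpooling market described in the context. If the network is series-parallel and all riders have identical carpool disutility parameters, i.e. $\gamma^m(d)=\gamma(d)$ for all $d=1,\dots,A$ and all $m\in M$, then a market equilibrium $(x^*,p^*,\tau^* )$ exists.
   Context: Network and riders. A finite directed network with a single origin–destination pair has edge set $E$, positive integer edge capacities $q_e$ and edge travel times $t_e>0$ ($e\in E$). $R$ is the set of routes (directed paths from origin to destination), and $t_r=\sum_{e\in r}t_e$. $M$ is a finite set of riders, $A$ a positive integer (car capacity), and $B$ the set of nonempty groups $b\subseteq M$ with $|b|\le A$. A trip is a pair $(b,r)\in B\times R$. Rider $m$ has real parameters $\alpha^m$ (value of arriving), $\beta^m\ge 0$ (value of time) and carpool disutilities $\gamma^m(d)\ge 0$, $d=1,\dots,A$, with $\gamma^m(1)=0$ and $\gamma^m(d)-\gamma^m(d-1)$ non-decreasing in $d=2,\dots,A$; $\delta\ge 0$ is a constant. For $m\in b$: $v_r^m(b)=\alpha^m-\beta^m t_r-\gamma^m(|b|)t_r$. The trip cost is $c_r(b)=\delta|b|t_r$, and the trip value is $V_r(b)=\sum_{m\in b}v_r^m(b)-c_r(b)$. Series-parallel. A network is series-parallel if it is a single edge from origin to destination, or is obtained from two series-parallel networks by connecting them in series (destination of the first identified with origin of the second) or in parallel (origins identified and destinations identified), finitely many times. Market outcomes. An outcome is $(x,p,\tau)$ with trip vector $x=(x_r(b))_{r\in R,b\in B}\in\{0,1\}^{B\times R}$ satisfying $\sum_{r}\sum_{b\ni m}x_r(b)\le 1$ for all $m\in M$ and $\sum_{r\ni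 e}\sum_{b\in B}x_r(b)\le q_e$ for all $e\in E$; payments $p=(p^m)_{m\in M}\in\mathbb{R}^M$; and tolls $\tau=(\tau_e)_{e\in E}\in\mathbb{R}_{\ge0}^E$. The induced utilities are $u^m=\sum_r\sum_{b\ni m}v_r^m(b)x_r(b)-p^m$. An outcome is a market equilibrium if it is: individually rational ($u^m\ge 0$ for all $m$); stable ($\sum_{m\in b}u^m\ge V_r(b)-\sum_{e\in r}\tau_e$ for all $b\in B$, $r\in R$); budget balanced (if $x_r(b)=1$ then $\sum_{m\in b}p^m=\sum_{e\in r}\tau_e+c_r(b)$; and if $x_r(b)=0$ for all $r\in R$ and all $b\ni m$ then $p^m=0$); and market clearing (if $\sum_{r\ni e}\sum_b x_r(b)<q_e$ then $\tau_e=0$). *)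

theory Defs
  imports Complex_Main "Graph_Theory.Graph_Theory"
begin

text \<open>
  Networks are multigraphs, since parallel composition can create parallel edges. Gluing is
  expressed internally: the two components are subgraphs over common vertex and arc types that
  have disjoint arc sets and share exactly the vertices to be identified. No closure under
  isomorphism is needed, because the image of such a gluing under an isomorphism is again the
  union of the images of its components.
\<close>

inductive series_parallel :: "('v, 'e) pre_digraph \<Rightarrow> 'v \<Rightarrow> 'v \<Rightarrow> bool" where
  single_edge:
    "\<lbrakk>verts G = {s, t}; arcs G = {e}; tail G e = s; head G e = t; s \<noteq> t\<rbrakk>
      \<Longrightarrow> series_parallel G s t"
| in_series:
    "\<lbrakk>series_parallel G s v; series_parallel H v t; compatible G H;
      verts G \<inter> verts H = {v}; arcs G \<inter> arcs H = {}\<rbrakk>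
      \<Longrightarrow> series_parallel (union G H) s t"
| in_parallel:
    "\<lbrakk>series_parallel G s t; series_parallel H s t; compatible G H;
      verts G \<inter> verts H = {s, t}; arcs G \<inter> arcs H = {}\<rbrakk>
      \<Longrightarrow> series_parallel (union G H) s t"

locale carpool_market = fin_digraph G for G :: "('v, 'e) pre_digraph" +
  fixes orig dest :: 'v
    and q :: "'e \<Rightarrow> nat"                     \<comment> \<open>edge capacities\<close>
    and t :: "'e \<Rightarrow> real"                    \<comment> \<open>edge travel times\<close>
    and M :: "'m set"                        \<comment> \<open>riders\<close>
    and A :: nat                             \<comment> \<open>car capacity\<close>
    and \<alpha> \<beta> :: "'m \<Rightarrow> real"                  \<comment> \<open>value of arriving, value of time\<close>
    and \<gamma> :: "'m \<Rightarrow> nat \<Rightarrow> real"             \<comment> \<open>carpool disutility by group size\<close>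
    and \<delta> :: real                            \<comment> \<open>cost per rider and unit of time\<close>
  assumes orig_in_verts: "orig \<in> verts G"
    and dest_in_verts: "dest \<in> verts G"
    and q_pos: "e \<in> arcs G \<Longrightarrow> 0 < q e"
    and t_pos: "e \<in> arcs G \<Longrightarrow> 0 < t e"
    and finite_riders: "finite M"
    and A_pos: "0 < A"
    and beta_nonneg: "m \<in> M \<Longrightarrow> 0 \<le> \<beta> m"
    and gamma_nonneg: "\<lbrakk>m \<in> M; d \<in> {1..A}\<rbrakk> \<Longrightarrow> 0 \<le> \<gamma> m d"
    and gamma_one: "m \<in> M \<Longrightarrow> \<gamma> m 1 = 0"
    and gamma_increments_mono: "m \<in> M \<Longrightarrow> mono_on {2..A} (\<lambda>d. \<gamma> m d - \<gamma> m (d - 1))"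
    and delta_nonneg: "0 \<le> \<delta>"
begin

definition routes :: "'e list set" where
  "routes = {r. apath orig r dest}"

definition groups :: "'m set set" where
  "groups = {b. b \<noteq> {} \<and> b \<subseteq> M \<and> card b \<le> A}"

text \<open>The sums over trips below therefore range over finite sets.\<close>

lemma finite_routes: "finite routes"
  unfolding routes_def by (rule apaths_finite)

lemma finite_groups: "finite groups"
  using finite_riders by (auto simp: groups_def intro: finite_subset [of _ "Pow M"])

definition route_time :: "'e list \<Rightarrow> real" where
  "route_time r = (\<Sum>e\<in>set r. t e)"

definition rider_value :: "'m \<Rightarrow> 'm set \<Rightarrow> 'e list \<Rightarrow> real" where
  "rider_value m b r = \<alpha> m - \<beta> m * route_time r - \<gamma> m (card b) * route_time r"

definition trip_cost :: "'m set \<Rightarrow> 'e list \<Rightarrow> real" where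
  "trip_cost b r = \<delta> * real (card b) * route_time r"

definition trip_value :: "'m set \<Rightarrow> 'e list \<Rightarrow> real" where
  "trip_value b r = (\<Sum>m\<in>b. rider_value m b r) - trip_cost b r"

text \<open>
  In the following, \<open>x b r\<close> is the entry of the trip vector for the trip \<open>(b, r)\<close>. Only the
  values of \<open>x\<close> on \<open>groups\<close> and \<open>routes\<close>, of \<open>p\<close> on \<open>M\<close> and of \<open>\<tau>\<close> on \<open>arcs G\<close> matter.
\<close>

definition edge_load :: "('m set \<Rightarrow> 'e list \<Rightarrow> nat) \<Rightarrow> 'e \<Rightarrow> nat" where
  "edge_load x e = (\<Sum>r\<in>{r \<in> routes. e \<in> set r}. \<Sum>b\<in>groups. x b r)"

definition feasible_trips :: "('m set \<Rightarrow> 'e list \<Rightarrow> nat) \<Rightarrow> bool" where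
  "feasible_trips x \<longleftrightarrow>
     (\<forall>b\<in>groups. \<forall>r\<in>routes. x b r \<in> {0, 1}) \<and>
     (\<forall>m\<in>M. (\<Sum>r\<in>routes. \<Sum>b\<in>{b \<in> groups. m \<in> b}. x b r) \<le> 1) \<and>
     (\<forall>e\<in>arcs G. edge_load x e \<le> q e)"

definition is_outcome ::
    "('m set \<Rightarrow> 'e list \<Rightarrow> nat) \<Rightarrow> ('m \<Rightarrow> real) \<Rightarrow> ('e \<Rightarrow> real) \<Rightarrow> bool" where
  "is_outcome x p \<tau> \<longleftrightarrow> feasible_trips x \<and> (\<forall>e\<in>arcs G. 0 \<le> \<tau> e)"

definition utility :: "('m set \<Rightarrow> 'e list \<Rightarrow> nat) \<Rightarrow> ('m \<Rightarrow> real) \<Rightarrow> 'm \<Rightarrow> real" where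
  "utility x p m =
     (\<Sum>r\<in>routes. \<Sum>b\<in>{b \<in> groups. m \<in> b}. rider_value m b r * real (x b r)) - p m"

definition individually_rational ::
    "('m set \<Rightarrow> 'e list \<Rightarrow> nat) \<Rightarrow> ('m \<Rightarrow> real) \<Rightarrow> bool" where
  "individually_rational x p \<longleftrightarrow> (\<forall>m\<in>M. 0 \<le> utility x p m)"

definition stable ::
    "('m set \<Rightarrow> 'e list \<Rightarrow> nat) \<Rightarrow> ('m \<Rightarrow> real) \<Rightarrow> ('e \<Rightarrow> real) \<Rightarrow> bool" where
  "stable x p \<tau> \<longleftrightarrow>
     (\<forall>b\<in>groups. \<forall>r\<in>routes. trip_value b r - (\<Sum>e\<in>set r. \<tau> e) \<le> (\<Sum>m\<in>b. utility x p m))"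

definition budget_balanced ::
    "('m set \<Rightarrow> 'e list \<Rightarrow> nat) \<Rightarrow> ('m \<Rightarrow> real) \<Rightarrow> ('e \<Rightarrow> real) \<Rightarrow> bool" where
  "budget_balanced x p \<tau> \<longleftrightarrow>
     (\<forall>b\<in>groups. \<forall>r\<in>routes. x b r = 1 \<longrightarrow>
        (\<Sum>m\<in>b. p m) = (\<Sum>e\<in>set r. \<tau> e) + trip_cost b r) \<and>
     (\<forall>m\<in>M. (\<forall>r\<in>routes. \<forall>b\<in>groups. m \<in> b \<longrightarrow> x b r = 0) \<longrightarrow> p m = 0)"

definition market_clearing :: "('m set \<Rightarrow> 'e list \<Rightarrow> nat) \<Rightarrow> ('e \<Rightarrow> real) \<Rightarrow> bool" where
  "market_clearing x \<tau> \<longleftrightarrow> (\<forall>e\<in>arcs G. edge_load x e < q e \<longrightarrow> \<tau> e = 0)"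

definition market_equilibrium ::
    "('m set \<Rightarrow> 'e list \<Rightarrow> nat) \<Rightarrow> ('m \<Rightarrow> real) \<Rightarrow> ('e \<Rightarrow> real) \<Rightarrow> bool" where
  "market_equilibrium x p \<tau> \<longleftrightarrow>
     is_outcome x p \<tau> \<and> individually_rational x p \<and> stable x p \<tau> \<and>
     budget_balanced x p \<tau> \<and> market_clearing x \<tau>"

end

end

theory Submission
  imports Defs "HOL-Combinatorics.Cycles"
begin

text \<open>
  On a series-parallel network there is a flow, given by a list of routes sorted by travel time,
  that is optimal for every convex non-increasing price \<open>\<Lambda>\<close> of travel times: some tolls make each
  route \<open>r\<close> cost at least \<open>\<Lambda> (t r)\<close>, with equality on the routes of the flow, and vanish on
  unsaturated edges. It suffices to check this for hinges \<open>max 0 (c - w * x)\<close>, since \<open>\<Lambda>\<close> is a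
  sum of hinges on any finite set of times; under series composition, where the routes are paired
  in sorted order, the threshold of a hinge splits between the two components.

  Treat the routes of this flow as slots. Since all riders have the same convex carpool
  disutility, a slot amounts to \<open>A\<close> seats of non-decreasing cost, so riders and slots form an
  assignment game, and duality yields groups and utilities \<open>u\<close>. The profit
  \<open>max\<^sub>b (V b z - u b)\<close> of a slot of travel time \<open>z\<close> is a maximum of non-increasing
  affine functions of \<open>z\<close>, hence an admissible \<open>\<Lambda>\<close>; its supporting tolls clear the market.
\<close>

section \<open>Duality for the assignment problem\<close>

fun path_weight :: "('a \<Rightarrow> 'a \<Rightarrow> real) \<Rightarrow> 'a list \<Rightarrow> real" where
  "path_weight l (x # y # xs) = l x y + path_weight l (y # xs)"
| "path_weight l _ = 0"

lemma path_weight_append: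
  "path_weight l (xs @ a # ys) = path_weight l (xs @ [a]) + path_weight l (a # ys)"
proof (induction xs rule: induct_list012)
  case (2 x)
  then show ?case by (cases ys) auto
qed auto

lemma path_weight_snoc:
  "path_weight l (a # xs @ [b]) = sum_list (map2 l (a # xs) (xs @ [b]))"
  by (induction xs arbitrary: a) auto

text \<open>Reads a simple cycle as a cyclic permutation, so that its weight can be compared with
  the values of assignments, which range over permutations.\<close>

lemma path_weight_cycle:
  assumes "distinct (a # xs)"
  shows "path_weight l (a # xs @ [a]) =
    (\<Sum>i\<in>set (a # xs). l i (cycle_of_list (a # xs) i))"
proof -
  let ?cs = "a # xs"
  have "xs @ [a] = map (cycle_of_list ?cs) ?cs"
    using cyclic_rotation [OF assms, of 1] by simp
  then have "path_weight l (a # xs @ [a]) = sum_list (map2 l ?cs (map (cycle_of_list ?cs) ?cs))"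
    using path_weight_snoc [of l a xs a] by simp
  also have "map2 l ?cs (map (cycle_of_list ?cs) ?cs) = map (\<lambda>i. l i (cycle_of_list ?cs i)) ?cs"
    by (simp add: zip_map2 zip_same_conv_map del: list.map zip_Cons_Cons)
  finally show ?thesis
    using assms by (simp only: sum_list_distinct_conv_sum_set)
qed

text \<open>Longest-path potential: \<open>u a\<close> is the largest weight of a simple path in
  \<open>V\<close> starting at \<open>a\<close>. Prefixing \<open>i\<close> to an optimal path from
  \<open>k\<close> either yields a simple path or closes a cycle at \<open>i\<close>; that cycle has
  weight at most 0, so cutting it off loses nothing.\<close>

lemma potential_exists:
  fixes l :: "'a \<Rightarrow> 'a \<Rightarrow> real"
  assumes "finite V"
    and cycle: "\<And>a xs. \<lbrakk>distinct (a # xs); set (a # xs) \<subseteq> V\<rbrakk> \<Longrightarrow> path_weight l (a # xs @ [a]) \<le> 0"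
  shows "\<exists>u. \<forall>i\<in>V. \<forall>k\<in>V. l i k + u k \<le> u i"
proof -
  define P where "P a = {xs. distinct (a # xs) \<and> set (a # xs) \<subseteq> V}" for a
  define u where "u a = Max ((\<lambda>xs. path_weight l (a # xs)) ` P a)" for a
  have fin: "finite (P a)" for a
    by (rule finite_subset [OF _ finite_subset_distinct [OF \<open>finite V\<close>]]) (auto simp: P_def)
  have le_u: "path_weight l (a # xs) \<le> u a" if "xs \<in> P a" for a xs
    unfolding u_def using that fin by (intro Max_ge) auto
  have "l i k + u k \<le> u i" if "i \<in> V" "k \<in> V" for i k
  proof -
    have "[] \<in> P k"
      using that by (simp add: P_def)
    then have "u k \<in> (\<lambda>xs. path_weight l (k # xs)) ` P k"
      unfolding u_def using fin by (intro Max_in) auto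
    then obtain ys where ys: "ys \<in> P k" "u k = path_weight l (k # ys)"
      by auto
    show ?thesis
    proof (cases "i \<in> set (k # ys)")
      case False
      then have "k # ys \<in> P i"
        using ys that by (auto simp: P_def)
      from le_u [OF this] show ?thesis
        using ys by simp
    next
      case True
      then obtain us vs where split: "k # ys = us @ i # vs"
        by (meson split_list)
      have "vs \<in> P i" and dist: "distinct (i # us)" "set (i # us) \<subseteq> V"
        using ys(1) unfolding P_def mem_Collect_eq split by auto
      have "l i k + path_weight l (us @ [i]) = path_weight l (i # us @ [i])"
      proof (cases us)
        case Nil
        then show ?thesis using split by simp
      next
        case (Cons x us')
        then show ?thesis using split by simp
      qed
      also have "\<dots> \<le> 0"
        using cycle [OF dist] .
      finally have "l i k + u k \<le> path_weight l (i # vs)"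
        unfolding ys(2) split path_weight_append [of l us i vs] by simp
      also have "\<dots> \<le> u i"
        using le_u \<open>vs \<in> P i\<close> .
      finally show ?thesis .
    qed
  qed
  then show ?thesis by blast
qed

text \<open>An optimal assignment admits no improving cyclic exchange, so the exchange gains have a
  potential. It serves as \<open>u\<close>, and \<open>v\<close> is then forced by tightness on the
  matched pairs.\<close>

lemma perfect_assignment_duality:
  fixes W :: "'a \<Rightarrow> 'b \<Rightarrow> real"
  assumes "finite I" "finite J" "card I = card J"
  obtains s u v where "bij_betw s I J"
    and "\<And>i j. \<lbrakk>i \<in> I; j \<in> J\<rbrakk> \<Longrightarrow> W i j \<le> u i + v j"
    and "\<And>i. i \<in> I \<Longrightarrow> u i + v (s i) = W i (s i)"
proof -
  obtain s0 where s0: "bij_betw s0 I J"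
    using finite_same_card_bij assms by blast
  define val where "val p = (\<Sum>i\<in>I. W i (s0 (p i)))" for p
  have fin: "finite (val ` {p. p permutes I})" and ne: "val ` {p. p permutes I} \<noteq> {}"
    using finite_permutations [OF \<open>finite I\<close>] permutes_id [of I] by blast+
  obtain p where p: "p permutes I" and "val p = Max (val ` {p. p permutes I})"
    using Max_in [OF fin ne] by auto
  then have max: "val p' \<le> val p" if "p' permutes I" for p'
    using fin that by simp
  define s where "s = s0 \<circ> p"
  have bij: "bij_betw s I J"
    unfolding s_def using bij_betw_trans [OF permutes_imp_bij [OF p] s0] .
  \<comment> \<open>The gain when \<open>i\<close> replaces \<open>k\<close> as the partner of
    \<open>s k\<close>. Around a cycle these gains add up to the change in value of the assignment,
    which is at most 0 by maximality.\<close>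
  define l where "l i k = W i (s k) - W k (s k)" for i k
  have "path_weight l (a # xs @ [a]) \<le> 0" if "distinct (a # xs)" "set (a # xs) \<subseteq> I" for a xs
  proof -
    let ?c = "cycle_of_list (a # xs)"
    have c: "?c permutes I"
      using permutes_subset [OF cycle_permutes that(2)] .
    have "path_weight l (a # xs @ [a]) = (\<Sum>i\<in>set (a # xs). l i (?c i))"
      using path_weight_cycle that(1) .
    \<comment> \<open>Rows off the cycle are fixed by \<open>?c\<close>, and
      \<open>l i i = 0\<close>.\<close>
    also have "\<dots> = (\<Sum>i\<in>I. l i (?c i))"
      using \<open>finite I\<close> that(2) id_outside_supp [of _ "a # xs"]
      by (intro sum.mono_neutral_left) (auto simp: l_def simp del: cycle_of_list.simps)
    also have "\<dots> = val (p \<circ> ?c) - (\<Sum>i\<in>I. W (?c i) (s (?c i)))"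
      by (simp add: l_def val_def s_def sum_subtractf)
    also have "(\<Sum>i\<in>I. W (?c i) (s (?c i))) = (\<Sum>i\<in>I. W i (s i))"
      using sum.permute [OF c, of "\<lambda>i. W i (s i)"] by (simp add: o_def)
    also have "\<dots> = val p"
      by (simp add: val_def s_def)
    also have "val (p \<circ> ?c) - val p \<le> 0"
      using max [OF permutes_compose [OF c p]] by simp
    finally show ?thesis .
  qed
  then obtain u where u: "\<And>i k. \<lbrakk>i \<in> I; k \<in> I\<rbrakk> \<Longrightarrow> l i k + u k \<le> u i"
    using potential_exists [OF \<open>finite I\<close>, of l] by blast
  define g where "g = inv_into I s"
  define v where "v j = W (g j) j - u (g j)" for j
  have g: "g j \<in> I" "s (g j) = j" if "j \<in> J" for j
    using bij that unfolding g_def bij_betw_def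
    by (auto intro: inv_into_into f_inv_into_f)
  have gs: "g (s i) = i" if "i \<in> I" for i
    using bij that unfolding g_def bij_betw_def by simp
  show thesis
  proof (rule that [OF bij])
    show "W i j \<le> u i + v j" if "i \<in> I" "j \<in> J" for i j
      using u [of i "g j"] g [OF that(2)] that by (simp add: l_def v_def)
    show "u i + v (s i) = W i (s i)" if "i \<in> I" for i
      using gs that by (simp add: v_def)
  qed
qed

text \<open>
  Reduction to the square case: pad with dummies of weight 0, one more on each side than needed,
  so that some dummy is matched to a dummy; this pair normalises the potentials.
\<close>

lemma assignment_duality:
  fixes W :: "'a \<Rightarrow> 'b \<Rightarrow> real"
  assumes "finite I" "finite J"
  obtains K s u v where "K \<subseteq> I" "inj_on s K" "s ` K \<subseteq> J"
    and "\<And>i. i \<in> I \<Longrightarrow> 0 \<le> u i" "\<And>j. j \<in> J \<Longrightarrow> 0 \<le> v j"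
    and "\<And>i j. \<lbrakk>i \<in> I; j \<in> J\<rbrakk> \<Longrightarrow> W i j \<le> u i + v j"
    and "\<And>i. i \<in> K \<Longrightarrow> u i + v (s i) = W i (s i)"
    and "\<And>i. i \<in> I - K \<Longrightarrow> u i = 0" "\<And>j. j \<in> J - s ` K \<Longrightarrow> v j = 0"
proof -
  define rows where "rows = I <+> {..card J}"
  define cols where "cols = J <+> {..card I}"
  define W' where
    "W' x y = (case (x, y) of (Inl i, Inl j) \<Rightarrow> W i j | _ \<Rightarrow> 0)" for x :: "'a + nat" and y :: "'b + nat"
  have "finite rows" "finite cols" "card rows = card cols"
    using assms by (simp_all add: rows_def cols_def card_Plus)
  then obtain \<sigma> u v where bij: "bij_betw \<sigma> rows cols"
    and dom: "\<And>x y. \<lbrakk>x \<in> rows; y \<in> cols\<rbrakk> \<Longrightarrow> W' x y \<le> u x + v y"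
    and tight: "\<And>x. x \<in> rows \<Longrightarrow> u x + v (\<sigma> x) = W' x (\<sigma> x)"
    by (rule perfect_assignment_duality [where W = W']) blast
  have inj: "inj_on \<sigma> rows" and img: "\<sigma> ` rows = cols"
    using bij by (auto simp: bij_betw_def)
  \<comment> \<open>Pigeonhole: \<open>{..card J}\<close> has \<open>card J + 1\<close> elements,
    too many for all dummy rows to be matched to real columns.\<close>
  have "\<exists>a\<le>card J. \<exists>k. \<sigma> (Inr a) = Inr k"
  proof (rule ccontr)
    assume contr: "\<not> ?thesis"
    have sub: "\<sigma> ` Inr ` {..card J} \<subseteq> Inl ` J"
    proof
      fix y assume "y \<in> \<sigma> ` Inr ` {..card J}"
      then obtain a where a: "a \<le> card J" "y = \<sigma> (Inr a)" by auto
      then have "y \<in> cols"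
        using img by (auto simp: rows_def)
      then show "y \<in> Inl ` J"
        using contr a by (auto simp: cols_def)
    qed
    have "card (\<sigma> ` Inr ` {..card J}) = card (Inr ` {..card J} :: ('a + nat) set)"
      by (rule card_image, rule inj_on_subset [OF inj]) (auto simp: rows_def)
    also have "\<dots> = Suc (card J)"
      by (subst card_image) auto
    finally have "Suc (card J) \<le> card (Inl ` J :: ('b + nat) set)"
      using card_mono [OF _ sub] assms(2) by simp
    then show False
      by (simp add: card_image)
  qed
  then obtain a k where a: "a \<le> card J" and ak: "\<sigma> (Inr a) = Inr k" by blast
  have ra: "Inr a \<in> rows"
    using a by (auto simp: rows_def)
  have ck: "Inr k \<in> cols"
    using img imageI [OF ra, of \<sigma>] ak by simp
  \<comment> \<open>Raising \<open>u\<close> and lowering \<open>v\<close> by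
    \<open>v (Inr k)\<close> gives both dummies of this pair potential 0. Since every pair with a
    dummy has weight 0, domination against these two makes all shifted potentials
    non-negative.\<close>
  have norm: "u (Inr a) = - v (Inr k)"
    using tight [OF ra] by (simp add: W'_def ak)
  have u_ge: "- v (Inr k) \<le> u x" if "x \<in> rows" for x
    using dom [OF that ck] by (simp add: W'_def split: sum.splits)
  have v_ge: "v (Inr k) \<le> v y" if "y \<in> cols" for y
    using dom [OF ra that] norm by (simp add: W'_def)
  define K where "K = {i \<in> I. \<exists>j. \<sigma> (Inl i) = Inl j}"
  have "K \<subseteq> I" by (auto simp: K_def)
  define s where "s i = projl (\<sigma> (Inl i))" for i
  have \<sigma>K: "\<sigma> (Inl i) = Inl (s i)" if "i \<in> K" for i
    using that by (auto simp: K_def s_def)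
  have rI: "Inl i \<in> rows" if "i \<in> I" for i
    using that by (auto simp: rows_def)
  have cJ: "Inl j \<in> cols" if "j \<in> J" for j
    using that by (auto simp: cols_def)
  show thesis
  proof (rule that [of K s "\<lambda>i. u (Inl i) + v (Inr k)" "\<lambda>j. v (Inl j) - v (Inr k)"])
    show "K \<subseteq> I" by fact
    show "inj_on s K"
    proof (rule inj_onI)
      fix i i' assume "i \<in> K" "i' \<in> K" "s i = s i'"
      then have "\<sigma> (Inl i) = \<sigma> (Inl i')" "i \<in> I" "i' \<in> I"
        using \<open>K \<subseteq> I\<close> by (auto simp: \<sigma>K)
      then show "i = i'"
        using inj_onD [OF inj, of "Inl i" "Inl i'"] rI by simp
    qed
    show "s ` K \<subseteq> J"
    proof safe
      fix i assume "i \<in> K"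
      then have "Inl (s i) \<in> cols"
        using img imageI [OF rI, of i \<sigma>] \<sigma>K [of i] \<open>K \<subseteq> I\<close> by auto
      then show "s i \<in> J" by (auto simp: cols_def)
    qed
    show "0 \<le> u (Inl i) + v (Inr k)" if "i \<in> I" for i
      using u_ge [OF rI [OF that]] by simp
    show "0 \<le> v (Inl j) - v (Inr k)" if "j \<in> J" for j
      using v_ge [OF cJ [OF that]] by simp
    show "W i j \<le> u (Inl i) + v (Inr k) + (v (Inl j) - v (Inr k))" if "i \<in> I" "j \<in> J" for i j
      using dom [OF rI cJ, of i j] that by (simp add: W'_def)
    show "u (Inl i) + v (Inr k) + (v (Inl (s i)) - v (Inr k)) = W i (s i)" if "i \<in> K" for i
      using tight [OF rI, of i] \<sigma>K [OF that] that \<open>K \<subseteq> I\<close> by (auto simp: W'_def)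
    show "u (Inl i) + v (Inr k) = 0" if i: "i \<in> I - K" for i
    proof -
      obtain n where n: "\<sigma> (Inl i) = Inr n"
        using i that by (cases "\<sigma> (Inl i)") (auto simp: K_def)
      have "Inr n \<in> cols"
        using img imageI [OF rI, of i \<sigma>] i n by simp
      then show ?thesis
        using v_ge [of "Inr n"] u_ge [OF rI, of i] tight [OF rI, of i] i n by (simp add: W'_def)
    qed
    show "v (Inl j) - v (Inr k) = 0" if j: "j \<in> J - s ` K" for j
    proof -
      have "Inl j \<in> \<sigma> ` rows"
        using img cJ [of j] j by simp
      then obtain x where x: "x \<in> rows" "\<sigma> x = Inl j"
        by (metis imageE)
      have "W' x (Inl j) = 0"
      proof (cases x)
        case (Inl i)
        then have "i \<in> K" "s i = j"
          using x by (auto simp: K_def s_def rows_def)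
        then show ?thesis
          using j by blast
      qed (simp add: W'_def)
      then show ?thesis
        using tight [OF x(1)] u_ge [OF x(1)] v_ge [OF cJ, of j] j by (simp add: x(2))
    qed
  qed
qed

section \<open>Slots with non-decreasing marginal costs\<close>

text \<open>Remove the largest element of \<open>D\<close>: as \<open>D\<close> consists of positive
  integers, that element is at least \<open>card D\<close>, so by monotonicity its cost is at least
  that of index \<open>card D\<close>. This shows that filling the first seats of a slot is
  cheapest.\<close>

lemma sum_initial_segment_le:
  fixes c :: "nat \<Rightarrow> real"
  assumes "finite D" "D \<subseteq> {1..A}" "mono_on {1..A} c"
  shows "(\<Sum>d=1..card D. c d) \<le> (\<Sum>d\<in>D. c d)"
  using assms(1,2)
proof (induction D rule: finite_linorder_max_induct)
  case (insert b D)
  have "D \<subseteq> {1..b - 1}"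
  proof
    fix d assume "d \<in> D"
    then show "d \<in> {1..b - 1}"
      using insert.hyps(2) insert.prems by (auto dest!: bspec [of D _ d])
  qed
  then have "card D \<le> b - 1"
    using card_mono [of "{1..b - 1}" D] by simp
  then have "Suc (card D) \<le> b" "1 \<le> b" "b \<le> A"
    using insert.prems by auto
  then have "c (Suc (card D)) \<le> c b"
    using assms(3) by (auto intro: mono_onD)
  moreover have "b \<notin> D"
    using insert.hyps(2) by auto
  ultimately show ?case
    using insert by simp
qed simp

text \<open>
  Since the marginal costs \<open>c j\<close> of slot \<open>j\<close> are non-decreasing, the slot is equivalent to \<open>A\<close>
  separate seats priced at these marginal costs, and the market becomes an assignment game.
\<close>

lemma slot_equilibrium:
  fixes w :: "'m \<Rightarrow> nat \<Rightarrow> real" and c :: "nat \<Rightarrow> nat \<Rightarrow> real"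
  assumes "finite M" and mono: "\<And>j. j < n \<Longrightarrow> mono_on {1..A} (c j)"
  obtains b u where "\<And>j. j < n \<Longrightarrow> b j \<subseteq> M" "\<And>j. j < n \<Longrightarrow> card (b j) \<le> A"
    and "\<And>i j m. \<lbrakk>i < n; j < n; m \<in> b i; m \<in> b j\<rbrakk> \<Longrightarrow> i = j"
    and "\<And>m. m \<in> M \<Longrightarrow> 0 \<le> u m" "\<And>m. m \<in> M - (\<Union>j<n. b j) \<Longrightarrow> u m = 0"
    and "\<And>j b'. \<lbrakk>j < n; b' \<subseteq> M; card b' \<le> A\<rbrakk> \<Longrightarrow>
      (\<Sum>m\<in>b'. w m j - u m) - (\<Sum>d=1..card b'. c j d)
      \<le> (\<Sum>m\<in>b j. w m j - u m) - (\<Sum>d=1..card (b j). c j d)"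
proof -
  define J where "J = {..<n} \<times> {1..A}"
  have "finite J" by (simp add: J_def)
  obtain K s u v where K: "K \<subseteq> M" "inj_on s K" "s ` K \<subseteq> J"
    and u: "\<And>m. m \<in> M \<Longrightarrow> 0 \<le> u m" and v: "\<And>j. j \<in> J \<Longrightarrow> 0 \<le> v j"
    and dom: "\<And>m j. \<lbrakk>m \<in> M; j \<in> J\<rbrakk> \<Longrightarrow> (\<lambda>m (j, d). w m j - c j d) m j \<le> u m + v j"
    and tight: "\<And>m. m \<in> K \<Longrightarrow> u m + v (s m) = (\<lambda>m (j, d). w m j - c j d) m (s m)"
    and u0: "\<And>m. m \<in> M - K \<Longrightarrow> u m = 0" and v0: "\<And>j. j \<in> J - s ` K \<Longrightarrow> v j = 0"
    by (rule assignment_duality [OF \<open>finite M\<close> \<open>finite J\<close>, where W = "\<lambda>m (j, d). w m j - c j d"])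
      blast
  define b where "b j = {m \<in> K. fst (s m) = j}" for j
  have sK: "fst (s m) < n" "snd (s m) \<in> {1..A}" if "m \<in> K" for m
    using K(3) that by (auto simp: J_def)
  define D where "D j = snd ` s ` b j" for j
  have bK: "b j \<subseteq> K" for j by (auto simp: b_def)
  have fin: "finite (b j)" for j
    using bK K(1) \<open>finite M\<close> by (meson finite_subset)
  have inj: "inj_on (\<lambda>m. snd (s m)) (b j)" for j
    using K(2) by (auto simp: b_def inj_on_def prod_eq_iff)
  have D: "D j \<subseteq> {1..A}" "card (D j) = card (b j)" for j
    using sK inj [of j] by (auto simp: D_def b_def image_image card_image)
  have sum_D: "(\<Sum>m\<in>b j. f (snd (s m))) = (\<Sum>d\<in>D j. f d)" for f :: "nat \<Rightarrow> real" and j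
    using sum.reindex [OF inj [of j], of f] by (simp add: D_def image_image)
  \<comment> \<open>Tightness accounts for the occupied seats \<open>D j\<close>; the empty seats
    contribute nothing because their potential is 0.\<close>
  have profit: "(\<Sum>m\<in>b j. w m j - u m) - (\<Sum>d\<in>D j. c j d) = (\<Sum>d=1..A. v (j, d))"
    if "j < n" for j
  proof -
    have "(\<Sum>m\<in>b j. w m j - u m) = (\<Sum>m\<in>b j. c j (snd (s m)) + v (j, snd (s m)))"
    proof (rule sum.cong)
      fix m assume "m \<in> b j"
      then have "m \<in> K" "s m = (j, snd (s m))"
        by (auto simp: b_def)
      then show "w m j - u m = c j (snd (s m)) + v (j, snd (s m))"
        using tight [of m] by (cases "s m") auto
    qed simp
    also have "\<dots> = (\<Sum>d\<in>D j. c j d + v (j, d))"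
      using sum_D [of "\<lambda>d. c j d + v (j, d)"] .
    also have "\<dots> = (\<Sum>d\<in>D j. c j d) + (\<Sum>d\<in>D j. v (j, d))"
      by (rule sum.distrib)
    also have "(\<Sum>d\<in>D j. v (j, d)) = (\<Sum>d=1..A. v (j, d))"
    proof (rule sum.mono_neutral_left)
      show "\<forall>d\<in>{1..A} - D j. v (j, d) = 0"
      proof
        fix d assume d: "d \<in> {1..A} - D j"
        have "d \<in> D j" if "(j, d) = s m" "m \<in> K" for m
          using that unfolding D_def b_def image_image by (intro rev_image_eqI [of m]) (auto simp flip: that(1))
        then have "(j, d) \<notin> s ` K"
          using d by auto
        then show "v (j, d) = 0"
          using v0 [of "(j, d)"] d \<open>j < n\<close> by (auto simp: J_def)
      qed
    qed (use D in auto)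
    finally show ?thesis by simp
  qed
  show thesis
  proof (rule that [of b u])
    show "b j \<subseteq> M" for j
      using bK K(1) by blast
    show "card (b j) \<le> A" for j
      using card_mono [OF _ D(1) [of j]] D(2) by simp
    show "i = j" if "m \<in> b i" "m \<in> b j" for i j m
      using that by (auto simp: b_def)
    show "0 \<le> u m" if "m \<in> M" for m
      using u that .
    show "u m = 0" if "m \<in> M - (\<Union>j<n. b j)" for m
    proof -
      have "m \<notin> K"
        using that sK(1) by (auto simp: b_def)
      then show ?thesis
        using u0 that by blast
    qed
    show "(\<Sum>m\<in>b'. w m j - u m) - (\<Sum>d=1..card b'. c j d)
      \<le> (\<Sum>m\<in>b j. w m j - u m) - (\<Sum>d=1..card (b j). c j d)"
      if j: "j < n" and b': "b' \<subseteq> M" "card b' \<le> A" for j b'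
    proof -
      have "finite b'"
        using b'(1) \<open>finite M\<close> by (rule finite_subset)
      \<comment> \<open>A competing group is seated arbitrarily on the first \<open>card b'\<close>
        seats. Domination then bounds its profit by the potentials of these seats, hence by those of
        all \<open>A\<close> seats.\<close>
      then obtain h where h: "bij_betw h b' {1..card b'}"
        using finite_same_card_bij [of b' "{1..card b'}"] by auto
      have sum_h: "(\<Sum>m\<in>b'. f (h m)) = (\<Sum>d=1..card b'. f d)" for f :: "nat \<Rightarrow> real"
        using sum.reindex_bij_betw [OF h] .
      have "(\<Sum>m\<in>b'. w m j - u m) \<le> (\<Sum>m\<in>b'. c j (h m) + v (j, h m))"
      proof (rule sum_mono)
        fix m assume m: "m \<in> b'"
        then have "h m \<in> {1..card b'}"
          using h by (auto simp: bij_betw_def)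
        then have "(j, h m) \<in> J"
          using j b'(2) by (auto simp: J_def)
        then show "w m j - u m \<le> c j (h m) + v (j, h m)"
          using dom [of m "(j, h m)"] m b'(1) by auto
      qed
      also have "\<dots> = (\<Sum>d=1..card b'. c j d) + (\<Sum>d=1..card b'. v (j, d))"
        using sum_h [of "\<lambda>d. c j d + v (j, d)"] by (simp add: sum.distrib)
      also have "(\<Sum>d=1..card b'. v (j, d)) \<le> (\<Sum>d=1..A. v (j, d))"
        using b'(2) j v by (intro sum_mono2) (auto simp: J_def)
      finally have "(\<Sum>m\<in>b'. w m j - u m) - (\<Sum>d=1..card b'. c j d) \<le> (\<Sum>d=1..A. v (j, d))"
        by simp
      \<comment> \<open>The seats \<open>D j\<close> need not be the first ones, but moving the
        group to the first seats can only lower its cost.\<close>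
      also have "\<dots> \<le> (\<Sum>m\<in>b j. w m j - u m) - (\<Sum>d=1..card (b j). c j d)"
        using profit [OF j] sum_initial_segment_le [OF _ D(1) mono [OF j], of j] fin D(2)
        by (simp add: D_def)
      finally show ?thesis .
    qed
  qed
qed

section \<open>Sums of hinges\<close>

text \<open>Parametrised by \<open>c\<close> and the slope rather than by the kink
  \<open>c / w\<close>, so that non-negative constants are included as \<open>w = 0\<close> and
  \<open>c\<close> can be split additively between components in series.\<close>

definition hinge :: "real \<times> real \<Rightarrow> real \<Rightarrow> real" where
  "hinge = (\<lambda>(c, w) x. max 0 (c - w * x))"

lemma hinge_nonneg [simp]: "0 \<le> hinge k x"
  by (simp add: hinge_def split: prod.split)

text \<open>The subgradient hypothesis says that \<open>f\<close> is convex and non-increasing. The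
  points are added from right to left: a new hinge with kink at the previous minimum corrects the
  value at the new point and vanishes on the old ones.\<close>

lemma hinge_decomposition:
  fixes f :: "real \<Rightarrow> real"
  assumes "finite S" and nonneg: "\<And>x. 0 \<le> f x"
    and subgradient: "\<And>x. \<exists>s\<ge>0. \<forall>y. f x + s * (x - y) \<le> f y"
  obtains ks where "\<And>c w. (c, w) \<in> set ks \<Longrightarrow> 0 \<le> w"
    and "\<And>x. x \<in> S \<Longrightarrow> f x = (\<Sum>k\<leftarrow>ks. hinge k x)"
proof -
  have "\<exists>ks. (\<forall>(c, w)\<in>set ks. 0 \<le> w) \<and> (\<forall>x\<in>S. f x = (\<Sum>k\<leftarrow>ks. hinge k x)) \<and>
     (S \<noteq> {} \<longrightarrow> (\<exists>a s. \<forall>x\<le>Min S. (\<Sum>k\<leftarrow>ks. hinge k x) = a - s * x \<and> a - s * x \<le> f x))"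
    using \<open>finite S\<close>
  proof (induction rule: finite_linorder_min_induct)
    case empty
    show ?case by (intro exI [of _ "[]"]) auto
  next
    case (insert b S)
    obtain \<mu> where \<mu>: "0 \<le> \<mu>" "\<And>y. f b + \<mu> * (b - y) \<le> f y"
      using subgradient [of b] by blast
    have Min_ins: "Min (insert b S) = b"
      using insert.hyps by (intro Min_eqI) (auto intro: less_imp_le)
    show ?case
    proof (cases "S = {}")
      case True
      have "f b \<le> f x" if "x \<le> b" for x
        using \<mu>(2) [of x] mult_nonneg_nonneg [OF \<mu>(1), of "b - x"] that by simp
      then show ?thesis
        using True nonneg [of b]
        by (intro exI [of _ "[(f b, 0)]"] conjI impI exI [of _ "f b"] exI [of _ 0])
          (auto simp: hinge_def)
    next
      case False
      define m where "m = Min S"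
      have "m \<in> S" and m_le: "\<And>x. x \<in> S \<Longrightarrow> m \<le> x"
        using False insert.hyps(1) by (simp_all add: m_def)
      then have "b < m"
        using insert.hyps(2) by blast
      from insert.IH False obtain ks where ks: "\<forall>(c, w)\<in>set ks. 0 \<le> w"
        and eq: "\<forall>x\<in>S. f x = (\<Sum>k\<leftarrow>ks. hinge k x)"
        and "\<exists>a s. \<forall>x\<le>m. (\<Sum>k\<leftarrow>ks. hinge k x) = a - s * x \<and> a - s * x \<le> f x"
        unfolding m_def by blast
      then obtain a s where left: "\<And>x. x \<le> m \<Longrightarrow> (\<Sum>k\<leftarrow>ks. hinge k x) = a - s * x"
          "\<And>x. x \<le> m \<Longrightarrow> a - s * x \<le> f x"
        by blast
      define \<kappa> where "\<kappa> = (f b - (a - s * b)) / (m - b)"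
      have "0 \<le> \<kappa>"
        unfolding \<kappa>_def using left(2) [of b] \<open>b < m\<close> by simp
      have \<kappa>: "\<kappa> * (m - b) = f b - (a - s * b)"
        unfolding \<kappa>_def using \<open>b < m\<close> by simp
      have fm: "f m = a - s * m"
        using eq \<open>m \<in> S\<close> left(1) [of m] by simp
      have hinge_left: "hinge (\<kappa> * m, \<kappa>) x = \<kappa> * (m - x)" if "x \<le> m" for x
        using \<open>0 \<le> \<kappa>\<close> that by (simp add: hinge_def algebra_simps mult_left_mono)
      have hinge_right: "hinge (\<kappa> * m, \<kappa>) x = 0" if "m \<le> x" for x
        using \<open>0 \<le> \<kappa>\<close> that by (simp add: hinge_def mult_left_mono)
      \<comment> \<open>The new line is the chord of \<open>f\<close> through \<open>b\<close> and
        \<open>m\<close>. It is no steeper than the supporting line at \<open>b\<close>, hence stays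
        below \<open>f\<close> to the left of \<open>b\<close>.\<close>
      have slope: "s + \<kappa> \<le> \<mu>"
      proof -
        have "(s + \<kappa>) * (m - b) = f b - f m"
          unfolding distrib_right \<kappa> fm by (simp add: algebra_simps)
        also have "\<dots> \<le> \<mu> * (m - b)"
          using \<mu>(2) [of m] by (simp add: algebra_simps)
        finally show ?thesis
          using \<open>b < m\<close> by simp
      qed
      let ?ks = "(\<kappa> * m, \<kappa>) # ks"
      have "f x = (\<Sum>k\<leftarrow>?ks. hinge k x)" if "x \<in> insert b S" for x
      proof (cases "x = b")
        case True
        then show ?thesis
          using \<kappa> hinge_left [of b] left(1) [of b] \<open>b < m\<close> by simp
      next
        case False
        then show ?thesis
          using that eq hinge_right m_le by simp
      qed
      moreover have "(\<Sum>k\<leftarrow>?ks. hinge k x) = (a + \<kappa> * m) - (s + \<kappa>) * x" if "x \<le> b" for x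
        using hinge_left [of x] left(1) [of x] \<open>b < m\<close> that by (simp add: algebra_simps)
      moreover have "(a + \<kappa> * m) - (s + \<kappa>) * x \<le> f x" if "x \<le> b" for x
      proof -
        have "(a + \<kappa> * m) - (s + \<kappa>) * x = f b + (s + \<kappa>) * (b - x)"
          using \<kappa> by (simp add: algebra_simps)
        also have "\<dots> \<le> f b + \<mu> * (b - x)"
          using slope that by (simp add: mult_right_mono)
        also have "\<dots> \<le> f x"
          by (rule \<mu>(2))
        finally show ?thesis .
      qed
      ultimately show ?thesis
        using ks \<open>0 \<le> \<kappa>\<close> unfolding Min_ins
        by (intro exI [of _ ?ks] conjI impI exI [of _ "a + \<kappa> * m"] exI [of _ "s + \<kappa>"]) auto
    qed
  qed
  then obtain ks where "\<forall>(c, w)\<in>set ks. 0 \<le> w" "\<forall>x\<in>S. f x = (\<Sum>k\<leftarrow>ks. hinge k x)"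
    by blast
  then show thesis
    by (intro that [of ks]) auto
qed

section \<open>Flows on series-parallel networks\<close>

text \<open>The clause that no arc enters the origin or leaves the destination is what confines
  walks to components, since components meet only in terminals.\<close>

lemma series_parallel_terminals:
  assumes "series_parallel G s v"
  shows "wf_digraph G \<and> s \<in> verts G \<and> v \<in> verts G \<and> s \<noteq> v \<and>
    (\<forall>e\<in>arcs G. head G e \<noteq> s \<and> tail G e \<noteq> v)"
  using assms
proof (induction rule: series_parallel.induct)
  case (single_edge G s t e)
  then show ?case by (simp add: wf_digraph_def)
next
  case (in_series G s v H t)
  have eq: "tail H = tail G" "head H = head G"
    using in_series.hyps(3) by (simp_all add: compatible_def)
  have G: "tail G e \<in> verts G" "head G e \<in> verts G" "head G e \<noteq> s" "tail G e \<noteq> v" if "e \<in> arcs G" for e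
    using in_series.IH(1) that by (auto simp: wf_digraph_def)
  have H: "tail G e \<in> verts H" "head G e \<in> verts H" "head G e \<noteq> v" "tail G e \<noteq> t" if "e \<in> arcs H" for e
    using in_series.IH(2) that by (auto simp: wf_digraph_def eq)
  have terminals: "s \<in> verts G" "t \<in> verts H" "s \<noteq> v" "v \<noteq> t"
    using in_series.IH by simp_all
  have "s \<notin> verts H"
    using terminals(1,3) in_series.hyps(4) by (metis IntI singletonD)
  have "t \<notin> verts G"
    using terminals(2,4) in_series.hyps(4) by (metis IntI singletonD)
  have endsG: "head G e \<noteq> s \<and> tail G e \<noteq> t" if "e \<in> arcs G" for e
    using G [OF that] \<open>t \<notin> verts G\<close> by auto
  have endsH: "head G e \<noteq> s \<and> tail G e \<noteq> t" if "e \<in> arcs H" for e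
    using H [OF that] \<open>s \<notin> verts H\<close> by auto
  have "s \<noteq> t"
    using \<open>t \<in> verts H\<close> \<open>s \<notin> verts H\<close> by auto
  moreover have "wf_digraph (union G H)"
    by (rule wf_digraph.intro) (use G(1,2) H(1,2) in \<open>auto simp: union_def\<close>)
  ultimately show ?case
    using terminals endsG endsH by (simp add: union_def ball_Un)
next
  case (in_parallel G s t H)
  have eq: "tail H = tail G" "head H = head G"
    using in_parallel.hyps(3) by (simp_all add: compatible_def)
  have G: "tail G e \<in> verts G" "head G e \<in> verts G" "head G e \<noteq> s" "tail G e \<noteq> t" if "e \<in> arcs G" for e
    using in_parallel.IH(1) that by (auto simp: wf_digraph_def)
  have H: "tail G e \<in> verts H" "head G e \<in> verts H" "head G e \<noteq> s" "tail G e \<noteq> t" if "e \<in> arcs H" for e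
    using in_parallel.IH(2) that by (auto simp: wf_digraph_def eq)
  have "wf_digraph (union G H)"
    by (rule wf_digraph.intro) (use G(1,2) H(1,2) in \<open>auto simp: union_def\<close>)
  then show ?case
    using in_parallel.IH(1) G(3,4) H(3,4) by (auto simp: union_def)
qed

text \<open>\<open>S\<close> is an invariant set of vertices: a walk with arcs in \<open>E\<close>
  that starts in \<open>S\<close> never leaves it, so all its arcs lie in \<open>F\<close>.\<close>

lemma cas_confined:
  assumes "pre_digraph.cas G u p v" "set p \<subseteq> E" "u \<in> S"
    and "\<And>e. \<lbrakk>e \<in> E; tail G e \<in> S\<rbrakk> \<Longrightarrow> e \<in> F \<and> head G e \<in> S"
  shows "set p \<subseteq> F"
  using assms(1-3)
proof (induction p arbitrary: u)
  case (Cons e p)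
  then show ?case
    using assms(4) [of e] by (auto simp: pre_digraph.cas.simps)
qed simp

section \<open>Walks and paths in series and parallel compositions\<close>

lemma compatible_union:
  assumes "compatible G H"
  shows "compatible G (union G H)" "compatible H (union G H)"
  using assms by (simp_all add: compatible_def union_def)

lemma apath_union:
  assumes "compatible G H"
  shows "pre_digraph.apath G u p v \<Longrightarrow> pre_digraph.apath (union G H) u p v"
    and "pre_digraph.apath H u p v \<Longrightarrow> pre_digraph.apath (union G H) u p v"
  using compatible_cas [OF compatible_union(1) [OF assms]]
    compatible_cas [OF compatible_union(2) [OF assms]]
    compatible_awalk_verts [OF compatible_union(1) [OF assms]]
    compatible_awalk_verts [OF compatible_union(2) [OF assms]]
  by (auto simp: pre_digraph.apath_def pre_digraph.awalk_def union_def)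

text \<open>The first arc decides the component. Afterwards the walk cannot return to
  \<open>s\<close>, and the other common vertex \<open>v\<close> has no outgoing arc, so it never
  changes component.\<close>

lemma awalk_parallelE:
  assumes sp: "series_parallel G s v" "series_parallel H s v"
    and comp: "compatible G H" and "verts G \<inter> verts H = {s, v}"
    and walk: "pre_digraph.awalk (union G H) s p v"
  shows "pre_digraph.awalk G s p v \<or> pre_digraph.awalk H s p v"
proof -
  note G = series_parallel_terminals [OF sp(1)]
  note H = series_parallel_terminals [OF sp(2)]
  have eq: "tail H = tail G" "head H = head G"
    using comp by (auto simp: compatible_def)
  have cas: "pre_digraph.cas G s p v" "pre_digraph.cas H s p v" and arcs: "set p \<subseteq> arcs G \<union> arcs H"
    using walk compatible_cas [OF compatible_union(1) [OF comp]]
      compatible_cas [OF compatible_union(2) [OF comp]]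
    by (auto simp: pre_digraph.awalk_def union_def)
  have wf: "tail G e \<in> verts G \<and> head G e \<in> verts G" if "e \<in> arcs G" for e
    using G that by (auto simp: wf_digraph_def)
  have wfH: "tail G e \<in> verts H \<and> head G e \<in> verts H" if "e \<in> arcs H" for e
    using H that by (auto simp: wf_digraph_def eq)
  obtain e p' where p: "p = e # p'"
    using cas(1) G by (cases p) (auto simp: pre_digraph.cas.simps)
  have cas': "pre_digraph.cas G (head G e) p' v"
    using cas(1) by (auto simp: p pre_digraph.cas.simps)
  have "set p \<subseteq> arcs G \<or> set p \<subseteq> arcs H"
  proof (cases "e \<in> arcs G")
    case True
    have "set p' \<subseteq> arcs G"
      by (rule cas_confined [OF cas', where E = "arcs G \<union> arcs H" and S = "verts G - {s}"])
        (use arcs True G H wf wfH assms(4) eq in \<open>auto simp: p\<close>)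
    then show ?thesis
      using True by (simp add: p)
  next
    case False
    then have "e \<in> arcs H"
      using arcs by (simp add: p)
    have "set p' \<subseteq> arcs H"
      by (rule cas_confined [OF cas', where E = "arcs G \<union> arcs H" and S = "verts H - {s}"])
        (use arcs \<open>e \<in> arcs H\<close> G H wf wfH assms(4) eq in \<open>auto simp: p\<close>)
    then show ?thesis
      using \<open>e \<in> arcs H\<close> by (simp add: p)
  qed
  then show ?thesis
    using cas G H by (auto simp: pre_digraph.awalk_def)
qed

text \<open>The walk can pass from \<open>G\<close> to \<open>H\<close> only at \<open>v\<close>.
  From there it stays in \<open>H\<close>, because no arc of \<open>G\<close> leaves
  \<open>v\<close>.\<close>

lemma awalk_seriesE:
  assumes sp: "series_parallel G s v" "series_parallel H v t"
    and comp: "compatible G H" and inter: "verts G \<inter> verts H = {v}"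
    and walk: "pre_digraph.awalk (union G H) s p t"
  obtains p1 p2 where "p = p1 @ p2" "pre_digraph.awalk G s p1 v" "pre_digraph.awalk H v p2 t"
proof -
  note G = series_parallel_terminals [OF sp(1)]
  note H = series_parallel_terminals [OF sp(2)]
  have eq: "tail H = tail G" "head H = head G"
    using comp by (auto simp: compatible_def)
  have casH: "pre_digraph.cas H = pre_digraph.cas G"
    using compatible_cas [OF comp] by simp
  have cas: "pre_digraph.cas G s p t" and arcs: "set p \<subseteq> arcs G \<union> arcs H"
    using walk compatible_cas [OF compatible_union(1) [OF comp]]
    by (auto simp: pre_digraph.awalk_def union_def)
  have wf: "tail G e \<in> verts G \<and> head G e \<in> verts G" if "e \<in> arcs G" for e
    using G that by (auto simp: wf_digraph_def)
  have wfH: "tail G e \<in> verts H \<and> head G e \<in> verts H" if "e \<in> arcs H" for e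
    using H that by (auto simp: wf_digraph_def eq)
  have "\<exists>p1 p2. p = p1 @ p2 \<and> set p1 \<subseteq> arcs G \<and> pre_digraph.cas G u p1 v \<and>
      set p2 \<subseteq> arcs H \<and> pre_digraph.cas G v p2 t"
    if "pre_digraph.cas G u p t" "set p \<subseteq> arcs G \<union> arcs H" "u \<in> verts G" for u
    using that
  proof (induction p arbitrary: u)
    case Nil
    then have "u = t" "u = v"
      using H inter by (auto simp: pre_digraph.cas.simps)
    then show ?case
      by (auto simp: pre_digraph.cas.simps)
  next
    case (Cons e p)
    show ?case
    proof (cases "e \<in> arcs G")
      case True
      then obtain p1 p2 where "p = p1 @ p2" "set p1 \<subseteq> arcs G" "pre_digraph.cas G (head G e) p1 v"
          "set p2 \<subseteq> arcs H" "pre_digraph.cas G v p2 t"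
        using Cons.IH [of "head G e"] Cons.prems wf by (auto simp: pre_digraph.cas.simps)
      then show ?thesis
        using True Cons.prems
        by (intro exI [of _ "e # p1"] exI [of _ p2]) (auto simp: pre_digraph.cas.simps)
    next
      case False
      then have "e \<in> arcs H"
        using Cons.prems by simp
      then have "u = v"
        using wfH [of e] Cons.prems inter by (auto simp: pre_digraph.cas.simps)
      have "set (e # p) \<subseteq> arcs H"
        by (rule cas_confined [OF Cons.prems(1,2), where S = "verts H"])
          (use G H wf wfH inter \<open>u = v\<close> in auto)
      then show ?thesis
        using Cons.prems \<open>u = v\<close>
        by (intro exI [of _ "[]"] exI [of _ "e # p"]) (auto simp: pre_digraph.cas.simps)
    qed
  qed
  then obtain p1 p2 where "p = p1 @ p2" "set p1 \<subseteq> arcs G" "pre_digraph.cas G s p1 v"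
      "set p2 \<subseteq> arcs H" "pre_digraph.cas G v p2 t"
    using cas arcs G by blast
  then show thesis
    using that G H by (simp add: pre_digraph.awalk_def casH)
qed

text \<open>The concatenation repeats no vertex: past its first vertex \<open>v\<close>, the second
  path stays in \<open>verts H - {v}\<close>, which is disjoint from \<open>verts G\<close>.\<close>

lemma apath_series:
  assumes sp: "series_parallel G s v" "series_parallel H v t"
    and comp: "compatible G H" and inter: "verts G \<inter> verts H = {v}"
    and p: "pre_digraph.apath G s p v" "pre_digraph.apath H v p' t"
  shows "pre_digraph.apath (union G H) s (p @ p') t"
proof -
  note G = series_parallel_terminals [OF sp(1)]
  note H = series_parallel_terminals [OF sp(2)]
  have wf: "wf_digraph (union G H)" "wf_digraph G" "wf_digraph H"
    using G H comp by (auto simp: wf_digraph_def union_def compatible_def)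
  have av: "pre_digraph.awalk_verts (union G H) = pre_digraph.awalk_verts G"
      "pre_digraph.awalk_verts H = pre_digraph.awalk_verts G"
    using compatible_awalk_verts [OF compatible_union(1) [OF comp]] compatible_awalk_verts [OF comp]
    by simp_all
  have last: "last (pre_digraph.awalk_verts G s p) = v"
    and sub: "set (pre_digraph.awalk_verts G s p) \<subseteq> verts G"
    using p(1) wf_digraph.awalkE [OF wf(2)] by (metis pre_digraph.apath_def)+
  have "set (pre_digraph.awalk_verts G v p') \<subseteq> verts H" "hd (pre_digraph.awalk_verts G v p') = v"
    using p(2) wf_digraph.awalkE [OF wf(3)] av(2) by (metis pre_digraph.apath_def)+
  moreover have "distinct (pre_digraph.awalk_verts G v p')"
    using p(2) av(2) by (simp add: pre_digraph.apath_def)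
  ultimately have "set (tl (pre_digraph.awalk_verts G v p')) \<subseteq> verts H - {v}"
    by (cases "pre_digraph.awalk_verts G v p'") auto
  then have "set (pre_digraph.awalk_verts G s p) \<inter> set (tl (pre_digraph.awalk_verts G v p')) = {}"
    using sub inter by blast
  then show ?thesis
    using wf_digraph.apath_append_iff [OF wf(1), of s p p' t] apath_union [OF comp] p
    by (simp add: av(1) last)
qed

text \<open>Greedy scan, with \<open>l1\<close> and \<open>l2\<close> as lower bounds left by the
  pairs already passed. A pair with sum below \<open>c\<close> lies below both thresholds and
  becomes the new bounds. At the first pair with sum at least \<open>c\<close> the thresholds fit
  between the bounds and this pair, so all later pairs lie above. If a list runs out first, the
  bound for the other list becomes its threshold, so the leftovers lie above it.\<close>

lemma split_threshold_aux:
  fixes c :: real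
  assumes "sorted xs" "sorted ys" "l1 + l2 \<le> c" "\<forall>x\<in>set xs. l1 \<le> x" "\<forall>y\<in>set ys. l2 \<le> y"
  shows "\<exists>c1 c2. c1 + c2 = c \<and> l1 \<le> c1 \<and> l2 \<le> c2 \<and>
    (\<forall>(x, y)\<in>set (zip xs ys). x \<le> c1 \<and> y \<le> c2 \<or> c1 \<le> x \<and> c2 \<le> y) \<and>
    (\<forall>x\<in>set (drop (length ys) xs). c1 \<le> x) \<and> (\<forall>y\<in>set (drop (length xs) ys). c2 \<le> y)"
  using assms
proof (induction xs ys arbitrary: l1 l2 rule: list_induct2')
  case 1
  then show ?case by (intro exI [of _ l1] exI [of _ "c - l1"]) auto
next
  case (2 x xs)
  then show ?case by (intro exI [of _ l1] exI [of _ "c - l1"]) auto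
next
  case (3 y ys)
  then show ?case by (intro exI [of _ "c - l2"] exI [of _ l2]) auto
next
  case (4 x xs y ys)
  show ?case
  proof (cases "c \<le> x + y")
    case True
    define c1 where "c1 = max l1 (c - y)"
    have "l1 \<le> c1" "c1 \<le> x" "l2 \<le> c - c1" "c - c1 \<le> y"
      using True 4(2-) by (auto simp: c1_def)
    moreover have "\<forall>x'\<in>set xs. x \<le> x'" "\<forall>y'\<in>set ys. y \<le> y'"
      using 4(2-) by auto
    ultimately show ?thesis
      by (intro exI [of _ c1] exI [of _ "c - c1"])
        (fastforce dest: set_zip_leftD set_zip_rightD in_set_dropD)
  next
    case False
    from 4 have "sorted xs" "sorted ys" "\<forall>x'\<in>set xs. x \<le> x'" "\<forall>y'\<in>set ys. y \<le> y'"
      by auto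
    with 4(1) [of x y] False obtain c1 c2 where c: "c1 + c2 = c" "x \<le> c1" "y \<le> c2"
      "\<forall>(x, y)\<in>set (zip xs ys). x \<le> c1 \<and> y \<le> c2 \<or> c1 \<le> x \<and> c2 \<le> y"
      "\<forall>x\<in>set (drop (length ys) xs). c1 \<le> x" "\<forall>y\<in>set (drop (length xs) ys). c2 \<le> y"
      by force
    moreover have "l1 \<le> x" "l2 \<le> y"
      using 4(2-) by auto
    ultimately show ?thesis
      by (intro exI [of _ c1] exI [of _ c2]) auto
  qed
qed

text \<open>
  Sorted lists are paired so that a hinge at \<open>c\<close> of the sum splits into hinges at \<open>c1\<close> and \<open>c2\<close>:
  the two members of each pair lie on the same side of their thresholds.
\<close>

lemma split_threshold:
  fixes c :: real
  assumes "sorted xs" "sorted ys"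
  obtains c1 c2 where "c1 + c2 = c"
    and "\<And>x y. (x, y) \<in> set (zip xs ys) \<Longrightarrow> x \<le> c1 \<and> y \<le> c2 \<or> c1 \<le> x \<and> c2 \<le> y"
    and "\<And>x. x \<in> set (drop (length ys) xs) \<Longrightarrow> c1 \<le> x"
    and "\<And>y. y \<in> set (drop (length xs) ys) \<Longrightarrow> c2 \<le> y"
proof -
  define l where "l = Min (set (c / 2 # xs @ ys))"
  have "l \<le> z" if "z \<in> set (c / 2 # xs @ ys)" for z
    unfolding l_def using that by (intro Min_le) auto
  from this [of "c / 2"] this have "l + l \<le> c" "\<forall>x\<in>set xs. l \<le> x" "\<forall>y\<in>set ys. l \<le> y"
    by auto
  then obtain c1 c2 where c: "c1 + c2 = c"
    "\<forall>(x, y)\<in>set (zip xs ys). x \<le> c1 \<and> y \<le> c2 \<or> c1 \<le> x \<and> c2 \<le> y"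
    "\<forall>x\<in>set (drop (length ys) xs). c1 \<le> x" "\<forall>y\<in>set (drop (length xs) ys). c2 \<le> y"
    using split_threshold_aux [OF assms, of l l c] by blast
  show thesis
    by (rule that [of c1 c2]) (use c in blast)+
qed

section \<open>Flows and the tolls that support them\<close>

definition route_load :: "'e list list \<Rightarrow> 'e \<Rightarrow> nat" where
  "route_load rs e = length (filter (\<lambda>r. e \<in> set r) rs)"

lemma route_load_append [simp]: "route_load (rs @ rs') e = route_load rs e + route_load rs' e"
  by (simp add: route_load_def)

lemma route_load_sort_key [simp]: "route_load (sort_key f rs) e = route_load rs e"
  by (simp add: route_load_def filter_sort)

lemma route_load_eq_0: "route_load rs e = 0 \<longleftrightarrow> (\<forall>r\<in>set rs. e \<notin> set r)"
  by (auto simp: route_load_def filter_empty_conv)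

lemma route_load_map2_left:
  assumes "\<forall>r\<in>set rs'. e \<notin> set r"
  shows "route_load (map2 (@) rs rs') e = route_load (take (length rs') rs) e"
  using assms by (induction rs rs' rule: list_induct2') (auto simp: route_load_def)

lemma route_load_map2_right:
  assumes "\<forall>r\<in>set rs. e \<notin> set r"
  shows "route_load (map2 (@) rs rs') e = route_load (take (length rs) rs') e"
  using assms by (induction rs rs' rule: list_induct2') (auto simp: route_load_def)

text \<open>Dual feasibility and complementary slackness for the flow \<open>rs\<close> at price
  \<open>f\<close>. The lower bound is imposed on all walks, so that the two pieces of a walk
  through a series composition need no check of distinctness.\<close>

definition supporting_tolls ::
    "('v, 'e) pre_digraph \<Rightarrow> 'v \<Rightarrow> 'v \<Rightarrow> ('e \<Rightarrow> real) \<Rightarrow> ('e \<Rightarrow> nat) \<Rightarrow> 'e list list \<Rightarrow>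
     (real \<Rightarrow> real) \<Rightarrow> ('e \<Rightarrow> real) \<Rightarrow> bool" where
  "supporting_tolls G s v t q rs f \<tau> \<longleftrightarrow> (\<forall>e. 0 \<le> \<tau> e) \<and>
     (\<forall>r. pre_digraph.awalk G s r v \<longrightarrow> f (sum t (set r)) \<le> sum \<tau> (set r)) \<and>
     (\<forall>r\<in>set rs. sum \<tau> (set r) = f (sum t (set r))) \<and>
     (\<forall>e\<in>arcs G. route_load rs e < q e \<longrightarrow> \<tau> e = 0)"

text \<open>For a fixed flow the conditions are preserved when prices and tolls are added. Hence a
  single flow that works for every hinge works for every sum of hinges.\<close>

lemma supporting_tolls_sum_list:
  assumes "\<And>k. k \<in> set ks \<Longrightarrow> \<exists>\<tau>. supporting_tolls G s v t q rs (f k) \<tau>"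
  shows "\<exists>\<tau>. supporting_tolls G s v t q rs (\<lambda>x. \<Sum>k\<leftarrow>ks. f k x) \<tau>"
  using assms
proof (induction ks)
  case Nil
  show ?case by (intro exI [of _ "\<lambda>_. 0"]) (simp add: supporting_tolls_def)
next
  case (Cons k ks)
  obtain \<tau> where "supporting_tolls G s v t q rs (\<lambda>x. \<Sum>k\<leftarrow>ks. f k x) \<tau>"
    using Cons by auto
  moreover obtain \<tau>' where "supporting_tolls G s v t q rs (f k) \<tau>'"
    using Cons.prems [of k] by auto
  ultimately have "supporting_tolls G s v t q rs (\<lambda>x. \<Sum>k\<leftarrow>k # ks. f k x) (\<lambda>e. \<tau>' e + \<tau> e)"
    by (auto simp: supporting_tolls_def sum.distrib intro: add_mono)
  then show ?case by blast
qed

lemma supporting_tolls_eq_0: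
  assumes "supporting_tolls G s v t q rs f \<tau>"
    and "r \<in> set rs" "e \<in> set r" "f (sum t (set r)) = 0"
  shows "\<tau> e = 0"
proof -
  have "sum \<tau> (set r) = 0"
    using assms by (simp add: supporting_tolls_def)
  then show ?thesis
    using assms(1,3) by (subst (asm) sum_nonneg_eq_0_iff) (auto simp: supporting_tolls_def)
qed

text \<open>The list is fixed before the hinge, as different hinges must share one flow to be
  summed. It is kept sorted so that routes can be paired by rank in a series composition.\<close>

definition supporting_flow ::
    "('v, 'e) pre_digraph \<Rightarrow> 'v \<Rightarrow> 'v \<Rightarrow> ('e \<Rightarrow> real) \<Rightarrow> ('e \<Rightarrow> nat) \<Rightarrow> 'e list list \<Rightarrow> bool" where
  "supporting_flow G s v t q rs \<longleftrightarrow>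
     (\<forall>r\<in>set rs. pre_digraph.apath G s r v) \<and>
     sorted (map (\<lambda>r. sum t (set r)) rs) \<and>
     (\<forall>e\<in>arcs G. route_load rs e \<le> q e) \<and>
     (\<forall>c w. 0 \<le> w \<longrightarrow> (\<exists>\<tau>. supporting_tolls G s v t q rs (hinge (c, w)) \<tau>))"

lemma supporting_flow_arcs:
  assumes "supporting_flow G s v t q rs" "r \<in> set rs"
  shows "set r \<subseteq> arcs G"
  using assms by (auto simp: supporting_flow_def pre_digraph.apath_def pre_digraph.awalk_def)

text \<open>With \<open>q e\<close> copies the edge is saturated, so its toll may be the price at
  its own travel time.\<close>

lemma supporting_flow_single_edge:
  assumes G: "verts G = {s, v}" "arcs G = {e}" "tail G e = s" "head G e = v" "s \<noteq> v"
  shows "supporting_flow G s v t q (replicate (q e) [e])"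
proof -
  have "pre_digraph.apath G s [e] v"
    using G by (simp add: pre_digraph.apath_def pre_digraph.awalk_def pre_digraph.cas.simps
        pre_digraph.awalk_verts.simps)
  moreover have "set r = {e}" if r: "pre_digraph.awalk G s r v" for r
  proof -
    have "set r \<subseteq> {e}" "r \<noteq> []"
      using r G by (auto simp: pre_digraph.awalk_def pre_digraph.cas.simps)
    then show ?thesis
      by (cases r) auto
  qed
  moreover have "route_load (replicate (q e) [e]) e = q e"
    by (simp add: route_load_def)
  ultimately have tolls:
      "supporting_tolls G s v t q (replicate (q e) [e]) (hinge k) (\<lambda>_. hinge k (t e))" for k
    using G by (auto simp: supporting_tolls_def)
  show ?thesis
    using \<open>pre_digraph.apath G s [e] v\<close> \<open>route_load _ e = q e\<close> tolls G
    by (auto simp: supporting_flow_def)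
qed

text \<open>\<open>map2\<close> joins routes of equal rank and drops the surplus of the longer list.
  With \<open>c\<close> split as in \<open>split_threshold\<close>, the two component hinges
  together dominate the hinge at \<open>c\<close>, with equality on the joined routes. Dropping
  surplus routes is harmless since their component hinge is 0.\<close>

lemma supporting_flow_series:
  assumes sp: "series_parallel G s v" "series_parallel H v z"
    and comp: "compatible G H" and inter: "verts G \<inter> verts H = {v}" "arcs G \<inter> arcs H = {}"
    and G: "supporting_flow G s v t q rs" and H: "supporting_flow H v z t q rs'"
  shows "supporting_flow (union G H) s z t q (map2 (@) rs rs')"
proof -
  let ?rs = "map2 (@) rs rs'"
  have arcs_union: "arcs (union G H) = arcs G \<union> arcs H"
    by (simp add: union_def)
  have sum_append: "sum f (set (r @ r')) = sum f (set r) + sum f (set r')"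
    if "set r \<subseteq> arcs G" "set r' \<subseteq> arcs H" for f :: "'b \<Rightarrow> real" and r r'
    using that inter(2) by (subst set_append, subst sum.union_disjoint) auto
  have pairE: "\<exists>r1 r2. r = r1 @ r2 \<and> (r1, r2) \<in> set (zip rs rs') \<and> r1 \<in> set rs \<and> r2 \<in> set rs' \<and>
      set r1 \<subseteq> arcs G \<and> set r2 \<subseteq> arcs H"
    if r: "r \<in> set ?rs" for r
  proof -
    obtain r1 r2 where r: "r = r1 @ r2" "(r1, r2) \<in> set (zip rs rs')"
      using r by auto
    moreover from r(2) have "r1 \<in> set rs" "r2 \<in> set rs'"
      by (auto dest: set_zip_leftD set_zip_rightD)
    ultimately show ?thesis
      using supporting_flow_arcs [OF G] supporting_flow_arcs [OF H] by blast
  qed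
  have loadG: "route_load ?rs e = route_load (take (length rs') rs) e" if "e \<in> arcs G" for e
    by (rule route_load_map2_left) (use supporting_flow_arcs [OF H] that inter(2) in blast)
  have loadH: "route_load ?rs e = route_load (take (length rs) rs') e" if "e \<in> arcs H" for e
    by (rule route_load_map2_right) (use supporting_flow_arcs [OF G] that inter(2) in blast)
  have split: "route_load rs e = route_load (take n rs) e + route_load (drop n rs) e"
    for n e and rs :: "'b list list"
    by (metis append_take_drop_id route_load_append)
  show ?thesis
    unfolding supporting_flow_def
  proof (intro conjI allI impI ballI)
    show "pre_digraph.apath (union G H) s r z" if "r \<in> set ?rs" for r
      using pairE [OF that] apath_series [OF sp comp inter(1)] G H
      by (auto simp: supporting_flow_def)
    show "sorted (map (\<lambda>r. sum t (set r)) ?rs)"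
      unfolding sorted_iff_nth_mono
    proof (intro allI impI)
      fix i j assume ij: "i \<le> j" "j < length (map (\<lambda>r. sum t (set r)) ?rs)"
      have nth: "map (\<lambda>r. sum t (set r)) ?rs ! k = sum t (set (rs ! k)) + sum t (set (rs' ! k))"
        if "k \<le> j" for k
        using that ij sum_append [of "rs ! k" "rs' ! k" t]
          supporting_flow_arcs [OF G, of "rs ! k"] supporting_flow_arcs [OF H, of "rs' ! k"]
        by simp
      have "sum t (set (rs ! i)) \<le> sum t (set (rs ! j))" "sum t (set (rs' ! i)) \<le> sum t (set (rs' ! j))"
        using ij G H sorted_nth_mono [of "map (\<lambda>r. sum t (set r)) rs" i j]
          sorted_nth_mono [of "map (\<lambda>r. sum t (set r)) rs'" i j]
        by (auto simp: supporting_flow_def)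
      then show "map (\<lambda>r. sum t (set r)) ?rs ! i \<le> map (\<lambda>r. sum t (set r)) ?rs ! j"
        unfolding nth [OF ij(1)] nth [OF order_refl] by (rule add_mono)
    qed
    show "route_load ?rs e \<le> q e" if "e \<in> arcs (union G H)" for e
    proof -
      have "route_load rs e \<le> q e" if "e \<in> arcs G"
        using G that by (simp add: supporting_flow_def)
      moreover have "route_load rs' e \<le> q e" if "e \<in> arcs H"
        using H that by (simp add: supporting_flow_def)
      ultimately show ?thesis
        using that loadG [of e] loadH [of e] split [of rs e "length rs'"] split [of rs' e "length rs"]
        unfolding arcs_union by auto
    qed
  next
    fix c w :: real assume "0 \<le> w"
    \<comment> \<open>Thresholds are compared with \<open>w\<close> times the travel time, which
      avoids dividing by \<open>w\<close> and covers \<open>w = 0\<close>.\<close>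
    define scaled where "scaled = map (\<lambda>r :: 'b list. w * sum t (set r))"
    have "sorted (map ((*) w) (map (\<lambda>r. sum t (set r)) rs))" "sorted (map ((*) w) (map (\<lambda>r. sum t (set r)) rs'))"
      using G H \<open>0 \<le> w\<close> unfolding supporting_flow_def
      by (auto simp: sorted_iff_nth_mono intro!: mult_left_mono)
    then have "sorted (scaled rs)" "sorted (scaled rs')"
      by (simp_all add: scaled_def comp_def)
    then obtain c1 c2 where c: "c1 + c2 = c"
      and same_side: "\<And>x y. (x, y) \<in> set (zip (scaled rs) (scaled rs')) \<Longrightarrow>
        x \<le> c1 \<and> y \<le> c2 \<or> c1 \<le> x \<and> c2 \<le> y"
      and drop1: "\<And>x. x \<in> set (drop (length (scaled rs')) (scaled rs)) \<Longrightarrow> c1 \<le> x"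
      and drop2: "\<And>y. y \<in> set (drop (length (scaled rs)) (scaled rs')) \<Longrightarrow> c2 \<le> y"
      by (rule split_threshold [where c = c]) blast
    obtain \<tau>1 where \<tau>1: "supporting_tolls G s v t q rs (hinge (c1, w)) \<tau>1"
      using G \<open>0 \<le> w\<close> unfolding supporting_flow_def by blast
    obtain \<tau>2 where \<tau>2: "supporting_tolls H v z t q rs' (hinge (c2, w)) \<tau>2"
      using H \<open>0 \<le> w\<close> unfolding supporting_flow_def by blast
    define \<tau> where "\<tau> e = (if e \<in> arcs G then \<tau>1 e else \<tau>2 e)" for e
    have sum\<tau>: "sum \<tau> (set (r @ r')) = sum \<tau>1 (set r) + sum \<tau>2 (set r')"
      if "set r \<subseteq> arcs G" "set r' \<subseteq> arcs H" for r r'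
    proof -
      have "sum \<tau> (set r) = sum \<tau>1 (set r)" "sum \<tau> (set r') = sum \<tau>2 (set r')"
        using that inter(2) by (auto simp: \<tau>_def disjoint_iff intro!: sum.cong)
      then show ?thesis
        using sum_append [OF that] by simp
    qed
    have "supporting_tolls (union G H) s z t q ?rs (hinge (c, w)) \<tau>"
      unfolding supporting_tolls_def
    proof (intro conjI allI impI ballI)
      show "0 \<le> \<tau> e" for e
        using \<tau>1 \<tau>2 by (simp add: \<tau>_def supporting_tolls_def)
      show "hinge (c, w) (sum t (set r)) \<le> sum \<tau> (set r)"
        if walk: "pre_digraph.awalk (union G H) s r z" for r
      proof -
        obtain r1 r2 where r: "r = r1 @ r2" "pre_digraph.awalk G s r1 v" "pre_digraph.awalk H v r2 z"
          using awalk_seriesE [OF sp comp inter(1) walk] .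
        then have sub: "set r1 \<subseteq> arcs G" "set r2 \<subseteq> arcs H"
          by (auto simp: pre_digraph.awalk_def)
        have "hinge (c, w) (sum t (set r))
            \<le> hinge (c1, w) (sum t (set r1)) + hinge (c2, w) (sum t (set r2))"
          unfolding r(1) sum_append [OF sub] c [symmetric] by (auto simp: hinge_def algebra_simps)
        also have "\<dots> \<le> sum \<tau>1 (set r1) + sum \<tau>2 (set r2)"
          using \<tau>1 \<tau>2 r by (auto simp: supporting_tolls_def intro!: add_mono)
        finally show ?thesis
          by (simp only: r(1) sum\<tau> [OF sub])
      qed
      show "sum \<tau> (set r) = hinge (c, w) (sum t (set r))" if r_in: "r \<in> set ?rs" for r
      proof -
        obtain r1 r2 where r: "r = r1 @ r2" "(r1, r2) \<in> set (zip rs rs')" "r1 \<in> set rs" "r2 \<in> set rs'"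
          and sub: "set r1 \<subseteq> arcs G" "set r2 \<subseteq> arcs H"
          using pairE [OF r_in] by blast
        have "(w * sum t (set r1), w * sum t (set r2)) \<in> set (zip (scaled rs) (scaled rs'))"
          unfolding scaled_def zip_map_map using r(2) by force
        from same_side [OF this]
        have "hinge (c, w) (sum t (set r))
            = hinge (c1, w) (sum t (set r1)) + hinge (c2, w) (sum t (set r2))"
          unfolding r(1) sum_append [OF sub] c [symmetric] by (auto simp: hinge_def algebra_simps)
        also have "\<dots> = sum \<tau>1 (set r1) + sum \<tau>2 (set r2)"
          using \<tau>1 \<tau>2 r by (auto simp: supporting_tolls_def)
        finally show ?thesis
          by (simp only: r(1) sum\<tau> [OF sub])
      qed
      show "\<tau> e = 0" if "e \<in> arcs (union G H)" and less: "route_load ?rs e < q e" for e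
      proof (cases "e \<in> arcs G")
        case True
        \<comment> \<open>Either no dropped route uses \<open>e\<close>, and \<open>e\<close> was
          already unsaturated in \<open>G\<close>, or some dropped route does; its price is 0, and
          so are all tolls on it. The case of \<open>H\<close> is symmetric.\<close>
        have "\<tau>1 e = 0"
        proof (cases "route_load (drop (length rs') rs) e = 0")
          case True
          then show ?thesis
            using \<tau>1 less loadG [OF \<open>e \<in> arcs G\<close>] split [of rs e "length rs'"] \<open>e \<in> arcs G\<close>
            by (simp add: supporting_tolls_def)
        next
          case False
          then obtain r where r: "r \<in> set (drop (length rs') rs)" "e \<in> set r"
            by (auto simp: route_load_eq_0)
          then have "w * sum t (set r) \<in> set (drop (length (scaled rs')) (scaled rs))"
            unfolding scaled_def drop_map length_map set_map by blast
          from drop1 [OF this] have "hinge (c1, w) (sum t (set r)) = 0"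
            by (simp add: hinge_def)
          then show ?thesis
            using supporting_tolls_eq_0 [OF \<tau>1] r in_set_dropD by metis
        qed
        then show ?thesis
          using True by (simp add: \<tau>_def)
      next
        case False
        then have "e \<in> arcs H"
          using that by (simp add: arcs_union)
        have "\<tau>2 e = 0"
        proof (cases "route_load (drop (length rs) rs') e = 0")
          case True
          then show ?thesis
            using \<tau>2 less loadH [OF \<open>e \<in> arcs H\<close>] split [of rs' e "length rs"] \<open>e \<in> arcs H\<close>
            by (simp add: supporting_tolls_def)
        next
          case False
          then obtain r where r: "r \<in> set (drop (length rs) rs')" "e \<in> set r"
            by (auto simp: route_load_eq_0)
          then have "w * sum t (set r) \<in> set (drop (length (scaled rs)) (scaled rs'))"
            unfolding scaled_def drop_map length_map set_map by blast
          from drop2 [OF this] have "hinge (c2, w) (sum t (set r)) = 0"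
            by (simp add: hinge_def)
          then show ?thesis
            using supporting_tolls_eq_0 [OF \<tau>2] r in_set_dropD by metis
        qed
        then show ?thesis
          using False by (simp add: \<tau>_def)
      qed
    qed
    then show "\<exists>\<tau>. supporting_tolls (union G H) s z t q ?rs (hinge (c, w)) \<tau>"
      by blast
  qed
qed

text \<open>Every walk between the terminals lies in one component, so the tolls for the same hinge
  in the two components are simply glued together.\<close>

lemma supporting_flow_parallel:
  assumes sp: "series_parallel G s v" "series_parallel H s v"
    and comp: "compatible G H" and inter: "verts G \<inter> verts H = {s, v}" "arcs G \<inter> arcs H = {}"
    and G: "supporting_flow G s v t q rs" and H: "supporting_flow H s v t q rs'"
  shows "supporting_flow (union G H) s v t q (sort_key (\<lambda>r. sum t (set r)) (rs @ rs'))"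
proof -
  let ?rs = "sort_key (\<lambda>r. sum t (set r)) (rs @ rs')"
  have arcs_union: "arcs (union G H) = arcs G \<union> arcs H"
    by (simp add: union_def)
  have loadG: "route_load ?rs e = route_load rs e" if "e \<in> arcs G" for e
  proof -
    have "route_load rs' e = 0"
      using supporting_flow_arcs [OF H] that inter(2) by (auto simp: route_load_eq_0)
    then show ?thesis by simp
  qed
  have loadH: "route_load ?rs e = route_load rs' e" if "e \<in> arcs H" for e
  proof -
    have "route_load rs e = 0"
      using supporting_flow_arcs [OF G] that inter(2) by (auto simp: route_load_eq_0)
    then show ?thesis by simp
  qed
  have "\<exists>\<tau>. supporting_tolls (union G H) s v t q ?rs (hinge (c, w)) \<tau>" if "0 \<le> w" for c w
  proof -
    obtain \<tau>1 where \<tau>1: "supporting_tolls G s v t q rs (hinge (c, w)) \<tau>1"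
      using G \<open>0 \<le> w\<close> unfolding supporting_flow_def by blast
    obtain \<tau>2 where \<tau>2: "supporting_tolls H s v t q rs' (hinge (c, w)) \<tau>2"
      using H \<open>0 \<le> w\<close> unfolding supporting_flow_def by blast
    define \<tau> where "\<tau> e = (if e \<in> arcs G then \<tau>1 e else \<tau>2 e)" for e
    have sumG: "sum \<tau> (set r) = sum \<tau>1 (set r)" if "set r \<subseteq> arcs G" for r
      using that by (auto simp: \<tau>_def intro!: sum.cong)
    have sumH: "sum \<tau> (set r) = sum \<tau>2 (set r)" if "set r \<subseteq> arcs H" for r
      using that inter(2) by (auto simp: \<tau>_def disjoint_iff intro!: sum.cong)
    have "supporting_tolls (union G H) s v t q ?rs (hinge (c, w)) \<tau>"
      unfolding supporting_tolls_def
    proof (intro conjI allI impI ballI)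
      show "0 \<le> \<tau> e" for e
        using \<tau>1 \<tau>2 by (simp add: \<tau>_def supporting_tolls_def)
      show "hinge (c, w) (sum t (set r)) \<le> sum \<tau> (set r)"
        if "pre_digraph.awalk (union G H) s r v" for r
        using awalk_parallelE [OF sp comp inter(1) that]
      proof
        assume r: "pre_digraph.awalk G s r v"
        then show ?thesis
          using \<tau>1 sumG [of r] by (auto simp: supporting_tolls_def pre_digraph.awalk_def)
      next
        assume r: "pre_digraph.awalk H s r v"
        then show ?thesis
          using \<tau>2 sumH [of r] by (auto simp: supporting_tolls_def pre_digraph.awalk_def)
      qed
      show "sum \<tau> (set r) = hinge (c, w) (sum t (set r))" if "r \<in> set ?rs" for r
        using that \<tau>1 \<tau>2 sumG [of r] sumH [of r] supporting_flow_arcs [OF G, of r]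
          supporting_flow_arcs [OF H, of r]
        by (auto simp: supporting_tolls_def)
      show "\<tau> e = 0" if "e \<in> arcs (union G H)" "route_load ?rs e < q e" for e
        using that \<tau>1 \<tau>2 loadG [of e] loadH [of e] unfolding arcs_union
        by (auto simp: supporting_tolls_def \<tau>_def)
    qed
    then show ?thesis by blast
  qed
  moreover have "pre_digraph.apath (union G H) s r v" if "r \<in> set ?rs" for r
    using that G H apath_union [OF comp] by (auto simp: supporting_flow_def)
  moreover have "route_load ?rs e \<le> q e" if "e \<in> arcs (union G H)" for e
    using that G H loadG [of e] loadH [of e] unfolding arcs_union
    by (auto simp: supporting_flow_def)
  ultimately show ?thesis
    unfolding supporting_flow_def by simp
qed

theorem series_parallel_supporting_flow:
  assumes "series_parallel G s v"
  shows "\<exists>rs. supporting_flow G s v t q rs"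
  using assms
proof (induction rule: series_parallel.induct)
  case (single_edge G s z e)
  then show ?case
    by (intro exI [of _ "replicate (q e) [e]"] supporting_flow_single_edge) simp_all
next
  case (in_series G s v H z)
  from in_series.IH obtain rs rs'
    where "supporting_flow G s v t q rs" "supporting_flow H v z t q rs'"
    by (elim exE)
  then show ?case
    using supporting_flow_series [OF in_series.hyps(1-5)] by (intro exI)
next
  case (in_parallel G s z H)
  from in_parallel.IH obtain rs rs'
    where "supporting_flow G s z t q rs" "supporting_flow H s z t q rs'"
    by (elim exE)
  then show ?case
    using supporting_flow_parallel [OF in_parallel.hyps(1-5)] by (intro exI)
qed

section \<open>Market equilibrium\<close>

text \<open>Turns sums over trips into sums over slots. Injectivity prevents two slots from being
  counted as one trip.\<close>

lemma sum_occupied_slots: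
  fixes \<phi> :: "'b \<Rightarrow> 'r \<Rightarrow> 'c::semiring_1" and b :: "nat \<Rightarrow> 'b" and f :: "nat \<Rightarrow> 'r"
  assumes fin: "finite R" "finite B"
    and inj: "inj_on (\<lambda>j. (f j, b j)) {j. j < n \<and> f j \<in> R \<and> b j \<in> B}"
  shows "(\<Sum>r\<in>R. \<Sum>b'\<in>B. \<phi> b' r * of_bool (\<exists>j<n. f j = r \<and> b j = b')) =
    (\<Sum>j | j < n \<and> f j \<in> R \<and> b j \<in> B. \<phi> (b j) (f j))"
proof -
  let ?J = "{j. j < n \<and> f j \<in> R \<and> b j \<in> B}"
  have "(\<Sum>r\<in>R. \<Sum>b'\<in>B. \<phi> b' r * of_bool (\<exists>j<n. f j = r \<and> b j = b')) =
      (\<Sum>z\<in>R \<times> B. \<phi> (snd z) (fst z) * of_bool (\<exists>j<n. f j = fst z \<and> b j = snd z))"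
    by (simp add: sum.cartesian_product case_prod_unfold)
  also have "\<dots> = (\<Sum>z\<in>(\<lambda>j. (f j, b j)) ` ?J. \<phi> (snd z) (fst z))"
    using fin by (intro sum.mono_neutral_cong_right) (auto simp: image_iff)
  also have "\<dots> = (\<Sum>j\<in>?J. \<phi> (b j) (f j))"
    by (subst sum.reindex [OF inj]) simp
  finally show ?thesis .
qed

section \<open>Convexity of the cost \<open>h d\<close> per unit of time of a group of size
  \<open>d\<close>\<close>

context
  fixes A :: nat and g h :: "nat \<Rightarrow> real" and \<delta> :: real
  assumes g_one: "g 1 = 0" and g_two: "2 \<le> A \<Longrightarrow> 0 \<le> g 2" and \<delta>: "0 \<le> \<delta>"
    and g_mono: "mono_on {2..A} (\<lambda>d. g d - g (d - 1))"
    and h_def: "h = (\<lambda>d. real d * (g d + \<delta>))"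
begin

text \<open>With \<open>D\<close> the increments of \<open>g\<close>, the second difference of
  \<open>h\<close> is \<open>d * (D (d + 1) - D d) + D (d + 1) + D d\<close>. All terms are
  non-negative, since the increments are non-decreasing from \<open>D 2 = g 2\<close>.\<close>

lemma marginal_cost_mono: "mono_on {1..A} (\<lambda>d. h d - h (d - 1))"
proof -
  have step: "h d - h (d - 1) \<le> h (Suc d) - h d" if d: "1 \<le> d" "Suc d \<le> A" for d
  \<comment> \<open>Treated separately because \<open>D 1\<close> would involve \<open>g 0\<close>,
    about which nothing is known; \<open>h 0 = 0\<close> holds through the factor
    \<open>d\<close>.\<close>
  proof (cases "d = 1")
    case True
    then show ?thesis
      using g_one g_two \<delta> d by (simp add: h_def numeral_2_eq_2)
  next
    case False
    with d have "2 \<le> d" "d \<le> A" by auto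
    define D where "D i = g i - g (i - 1)" for i
    have D_mono: "D i \<le> D j" if "2 \<le> i" "i \<le> j" "j \<le> A" for i j
      using mono_onD [OF g_mono, of i j] that by (simp add: D_def)
    have "0 \<le> D 2"
      using g_one g_two d \<open>2 \<le> d\<close> by (simp add: D_def)
    then have "0 \<le> D d" "0 \<le> D (Suc d)" "0 \<le> D (Suc d) - D d"
      using D_mono [of 2 d] D_mono [of d "Suc d"] \<open>2 \<le> d\<close> d by auto
    then have "0 \<le> real d * (D (Suc d) - D d) + D (Suc d) + D d"
      by simp
    also have "\<dots> = (h (Suc d) - h d) - (h d - h (d - 1))"
      using \<open>2 \<le> d\<close> by (simp add: D_def h_def of_nat_diff algebra_simps)
    finally show ?thesis by simp
  qed
  show ?thesis
  proof (rule mono_onI)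
    fix i j assume "i \<in> {1..A}" "j \<in> {1..A}" "i \<le> j"
    from \<open>i \<le> j\<close> have "j \<le> A \<longrightarrow> h i - h (i - 1) \<le> h j - h (j - 1)"
    proof (induction rule: dec_induct)
      case (step j)
      then show ?case
        using \<open>i \<in> {1..A}\<close> \<open>\<And>d. \<lbrakk>1 \<le> d; Suc d \<le> A\<rbrakk> \<Longrightarrow> h d - h (d - 1) \<le> h (Suc d) - h d\<close> [of j]
        by auto
    qed simp
    then show "h i - h (i - 1) \<le> h j - h (j - 1)"
      using \<open>j \<in> {1..A}\<close> by simp
  qed
qed

lemma cost_eq_sum_marginal_costs: "h n = (\<Sum>d=1..n. h d - h (d - 1))"
  by (induction n) (auto simp: h_def)

lemma cost_nonneg:
  assumes "n \<le> A"
  shows "0 \<le> h n"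
  unfolding cost_eq_sum_marginal_costs [of n]
proof (rule sum_nonneg)
  fix d assume "d \<in> {1..n}"
  then have "h 1 - h (1 - 1) \<le> h d - h (d - 1)"
    using mono_onD [OF marginal_cost_mono, of 1 d] assms by auto
  then show "0 \<le> h d - h (d - 1)"
    using \<delta> g_one by (simp add: h_def)
qed

end

context carpool_market
begin

lemma market_equilibrium_exists:
  assumes sp: "series_parallel G orig dest"
    and \<gamma>: "\<And>m d. \<lbrakk>m \<in> M; d \<in> {1..A}\<rbrakk> \<Longrightarrow> \<gamma> m d = g d"
    and g: "g 1 = 0" "2 \<le> A \<Longrightarrow> 0 \<le> g 2" "mono_on {2..A} (\<lambda>d. g d - g (d - 1))"
  shows "\<exists>x p \<tau>. market_equilibrium x p \<tau>"
proof -
  define h where "h = (\<lambda>d. real d * (g d + \<delta>))"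
  note h_mono = marginal_cost_mono [OF g(1,2) delta_nonneg g(3) h_def]
  note h_sum = cost_eq_sum_marginal_costs [OF g(1,2) delta_nonneg g(3) h_def]
  note h_nonneg = cost_nonneg [OF g(1,2) delta_nonneg g(3) h_def]
  have route_time: "route_time = (\<lambda>r. sum t (set r))"
    by (simp add: route_time_def fun_eq_iff)
  have routes_awalk: "awalk orig r dest" if "r \<in> routes" for r
    using that by (simp add: routes_def apath_def)
  obtain rs where flow: "supporting_flow G orig dest t q rs"
    using series_parallel_supporting_flow [OF sp] by blast
  define n where "n = length rs"
  define T where "T j = route_time (rs ! j)" for j
  have rs_routes: "rs ! j \<in> routes" if "j < n" for j
    using flow that by (auto simp: supporting_flow_def routes_def n_def)
  have T_nonneg: "0 \<le> T j" if "j < n" for j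
    unfolding T_def route_time_def
  proof (rule sum_nonneg)
    fix e assume "e \<in> set (rs ! j)"
    then have "e \<in> arcs G"
      using routes_awalk [OF rs_routes [OF that]] by (auto simp: awalk_def)
    then show "0 \<le> t e"
      using t_pos by (simp add: less_imp_le)
  qed
  txt \<open>
    Apart from terms additive over riders, a group \<open>b'\<close> of size \<open>d\<close> on slot \<open>j\<close> costs \<open>h d * T j\<close>;
    this is where identical carpool disutilities are needed.
  \<close>
  have "mono_on {1..A} (\<lambda>d. (h d - h (d - 1)) * T j)" if "j < n" for j
    using h_mono T_nonneg [OF that] by (auto simp: monotone_on_def intro: mult_right_mono)
  then obtain b u where b: "\<And>j. j < n \<Longrightarrow> b j \<subseteq> M" "\<And>j. j < n \<Longrightarrow> card (b j) \<le> A"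
    and disjoint: "\<And>i j m. \<lbrakk>i < n; j < n; m \<in> b i; m \<in> b j\<rbrakk> \<Longrightarrow> i = j"
    and u_nonneg: "\<And>m. m \<in> M \<Longrightarrow> 0 \<le> u m"
    and u_unmatched: "\<And>m. m \<in> M - (\<Union>j<n. b j) \<Longrightarrow> u m = 0"
    and best: "\<And>j b'. \<lbrakk>j < n; b' \<subseteq> M; card b' \<le> A\<rbrakk> \<Longrightarrow>
      (\<Sum>m\<in>b'. (\<alpha> m - \<beta> m * T j) - u m) - (\<Sum>d=1..card b'. (h d - h (d - 1)) * T j)
      \<le> (\<Sum>m\<in>b j. (\<alpha> m - \<beta> m * T j) - u m) - (\<Sum>d=1..card (b j). (h d - h (d - 1)) * T j)"
    by (rule slot_equilibrium [OF finite_riders, where n = n and A = A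
          and w = "\<lambda>m j. \<alpha> m - \<beta> m * T j" and c = "\<lambda>j d. (h d - h (d - 1)) * T j"]) blast+
  define profit where
    "profit b' z = (\<Sum>m\<in>b'. (\<alpha> m - \<beta> m * z) - u m) - h (card b') * z" for b' z
  \<comment> \<open>The empty group has profit 0: it makes \<open>\<Lambda>\<close> non-negative and
    allows slots to stay empty.\<close>
  define \<Lambda> where "\<Lambda> z = Max ((\<lambda>b'. profit b' z) ` insert {} groups)" for z
  have profit_le: "profit b' z \<le> \<Lambda> z" if "b' \<in> insert {} groups" for b' z
    unfolding \<Lambda>_def using finite_groups that by (intro Max_ge) auto
  have \<Lambda>_attained: "\<exists>b'\<in>insert {} groups. \<Lambda> z = profit b' z" for z
    using Max_in [of "(\<lambda>b'. profit b' z) ` insert {} groups"] finite_groups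
    unfolding \<Lambda>_def by auto
  have profit_empty: "profit {} z = 0" for z
    by (simp add: profit_def h_def)
  have profit_affine:
      "profit b' z = (\<Sum>m\<in>b'. \<alpha> m - u m) - ((\<Sum>m\<in>b'. \<beta> m) + h (card b')) * z" for b' z
    by (simp add: profit_def sum_subtractf sum_distrib_right distrib_right)
  have "0 \<le> \<Lambda> z" for z
    using profit_le [of "{}" z] profit_empty by simp
  \<comment> \<open>The subgradient is the slope of an affine profit function that attains the
    maximum at \<open>z\<close>.\<close>
  moreover have "\<exists>s\<ge>0. \<forall>y. \<Lambda> z + s * (z - y) \<le> \<Lambda> y" for z
  proof -
    obtain b' where b': "b' \<in> insert {} groups" "\<Lambda> z = profit b' z"
      using \<Lambda>_attained by blast
    define s where "s = (\<Sum>m\<in>b'. \<beta> m) + h (card b')"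
    have "0 \<le> s"
      unfolding s_def using b'(1) beta_nonneg h_nonneg [of "card b'"]
      by (auto simp: groups_def intro!: add_nonneg_nonneg sum_nonneg)
    moreover have "\<Lambda> z + s * (z - y) = profit b' y" for y
      unfolding b'(2) s_def profit_affine by (simp add: algebra_simps)
    then have "\<Lambda> z + s * (z - y) \<le> \<Lambda> y" for y
      using profit_le [OF b'(1)] by simp
    ultimately show ?thesis by blast
  qed
  ultimately obtain ks where ks: "\<And>c w. (c, w) \<in> set ks \<Longrightarrow> 0 \<le> w"
      "\<And>z. z \<in> route_time ` routes \<Longrightarrow> \<Lambda> z = (\<Sum>k\<leftarrow>ks. hinge k z)"
    using hinge_decomposition [of "route_time ` routes" \<Lambda>] finite_routes by blast
  have "\<exists>\<tau>. supporting_tolls G orig dest t q rs (\<lambda>z. \<Sum>k\<leftarrow>ks. hinge k z) \<tau>"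
  proof (rule supporting_tolls_sum_list)
    fix k assume "k \<in> set ks"
    moreover obtain c w where "k = (c, w)"
      by (rule prod.exhaust)
    ultimately show "\<exists>\<tau>. supporting_tolls G orig dest t q rs (hinge k) \<tau>"
      using flow ks(1) [of c w] by (simp add: supporting_flow_def)
  qed
  then obtain \<tau> where "supporting_tolls G orig dest t q rs (\<lambda>z. \<Sum>k\<leftarrow>ks. hinge k z) \<tau>"
    by blast
  note tolls = this [unfolded supporting_tolls_def, folded route_time]
  have \<tau>_nonneg: "0 \<le> \<tau> e" for e
    using tolls by blast
  have \<Lambda>_le: "\<Lambda> (route_time r) \<le> sum \<tau> (set r)" if "r \<in> routes" for r
    using tolls routes_awalk [OF that] ks(2) [of "route_time r"] that by (simp add: route_time)
  have \<Lambda>_slot: "sum \<tau> (set (rs ! j)) = \<Lambda> (T j)" if "j < n" for j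
    using tolls rs_routes [OF that] ks(2) [of "T j"] that by (simp add: route_time T_def n_def)

  have slot_groups: "b j \<in> groups" if "j < n" "b j \<noteq> {}" for j
    using b that by (simp add: groups_def)
  have profit_slot: "profit (b j) (T j) = \<Lambda> (T j)" if "j < n" for j
  proof (rule antisym)
    show "profit (b j) (T j) \<le> \<Lambda> (T j)"
      using profit_le slot_groups [OF that] by blast
    obtain b' where b': "b' \<in> insert {} groups" "\<Lambda> (T j) = profit b' (T j)"
      using \<Lambda>_attained by blast
    have "(\<Sum>d=1..card B. (h d - h (d - 1)) * T j) = h (card B) * T j" for B :: "'m set"
      by (simp only: h_sum [of "card B"] sum_distrib_right)
    then show "\<Lambda> (T j) \<le> profit (b j) (T j)"
      using best [OF that, of b'] b' by (auto simp: profit_def groups_def)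
  qed
  have trip_value: "trip_value b' r = profit b' (route_time r) + (\<Sum>m\<in>b'. u m)"
    if "b' \<in> groups" for b' r
  proof -
    have "card b' \<in> {1..A}"
      using that finite_subset [OF _ finite_riders, of b'] by (auto simp: groups_def Suc_le_eq card_gt_0_iff)
    then have "rider_value m b' r = (\<alpha> m - \<beta> m * route_time r) - g (card b') * route_time r"
      if "m \<in> b'" for m
      using \<gamma> [of m "card b'"] that \<open>b' \<in> groups\<close> by (auto simp: rider_value_def groups_def)
    then have "(\<Sum>m\<in>b'. rider_value m b' r) =
        (\<Sum>m\<in>b'. \<alpha> m - \<beta> m * route_time r) - real (card b') * (g (card b') * route_time r)"
      by (simp add: sum_subtractf)
    then show ?thesis
      unfolding trip_value_def trip_cost_def profit_def h_def sum_subtractf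
      by (simp add: algebra_simps)
  qed

  \<comment> \<open>Slots may repeat a route, but non-empty groups of different slots are disjoint
    and hence give different trips. Empty slots are not counted, as \<open>{}\<close> is not in
    \<open>groups\<close>.\<close>
  define x where "x b' r = (of_bool (\<exists>j<n. rs ! j = r \<and> b j = b') :: nat)" for b' r
  \<comment> \<open>Payments are chosen to leave each rider exactly \<open>u m\<close>. Budget
    balance then says that the profit of each occupied slot equals its toll.\<close>
  define p where
    "p m = (\<Sum>r\<in>routes. \<Sum>b'\<in>{b' \<in> groups. m \<in> b'}. rider_value m b' r * real (x b' r)) - u m" for m
  have utility: "utility x p m = u m" for m
    by (simp add: utility_def p_def)
  have inj: "inj_on (\<lambda>j. (rs ! j, b j)) {j. j < n \<and> P j \<and> b j \<in> groups \<and> Q j}" for P Q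
  proof (rule inj_onI)
    fix i j
    assume "i \<in> {j. j < n \<and> P j \<and> b j \<in> groups \<and> Q j}" "j \<in> {j. j < n \<and> P j \<and> b j \<in> groups \<and> Q j}"
      and eq: "(rs ! i, b i) = (rs ! j, b j)"
    then have ij: "i < n" "j < n" "b i \<noteq> {}" by (auto simp: groups_def)
    then obtain m where "m \<in> b i" by blast
    then show "i = j"
      using disjoint [of i j m] ij eq by simp
  qed
  have load: "edge_load x e = card {j. j < n \<and> e \<in> set (rs ! j) \<and> b j \<noteq> {}}" for e
  proof -
    have "edge_load x e = (\<Sum>j | j < n \<and> rs ! j \<in> {r \<in> routes. e \<in> set r} \<and> b j \<in> groups. 1)"
      unfolding edge_load_def x_def
      using sum_occupied_slots [of "{r \<in> routes. e \<in> set r}" groups "(!) rs" b n "\<lambda>_ _. 1 :: nat"]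
        inj [of "\<lambda>j. rs ! j \<in> {r \<in> routes. e \<in> set r}" "\<lambda>_. True"] finite_routes finite_groups
      by simp
    also have "{j. j < n \<and> rs ! j \<in> {r \<in> routes. e \<in> set r} \<and> b j \<in> groups} =
        {j. j < n \<and> e \<in> set (rs ! j) \<and> b j \<noteq> {}}"
      using rs_routes slot_groups by (auto simp: groups_def)
    finally show ?thesis by simp
  qed
  have rider_sum: "(\<Sum>r\<in>routes. \<Sum>b'\<in>{b' \<in> groups. m \<in> b'}. \<phi> b' r * real (x b' r)) =
      (\<Sum>j | j < n \<and> m \<in> b j. \<phi> (b j) (rs ! j))" for m \<phi>
  proof -
    have "(\<Sum>r\<in>routes. \<Sum>b'\<in>{b' \<in> groups. m \<in> b'}. \<phi> b' r * real (x b' r)) =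
        (\<Sum>j | j < n \<and> rs ! j \<in> routes \<and> b j \<in> {b' \<in> groups. m \<in> b'}. \<phi> (b j) (rs ! j))"
      unfolding x_def
      using sum_occupied_slots [of routes "{b' \<in> groups. m \<in> b'}" "(!) rs" b n \<phi>]
        inj [of "\<lambda>j. rs ! j \<in> routes" "\<lambda>j. m \<in> b j"] finite_routes finite_groups
      by simp
    also have "{j. j < n \<and> rs ! j \<in> routes \<and> b j \<in> {b' \<in> groups. m \<in> b'}} = {j. j < n \<and> m \<in> b j}"
      using rs_routes slot_groups by auto
    finally show ?thesis .
  qed
  have slots_of: "{i. i < n \<and> m \<in> b i} = {j}" if "j < n" "m \<in> b j" for m j
    using disjoint that by blast
  have load_full: "route_load rs e = card {j. j < n \<and> e \<in> set (rs ! j)}" for e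
    by (simp add: route_load_def length_filter_conv_card n_def)

  have "feasible_trips x"
    unfolding feasible_trips_def
  proof (intro conjI ballI)
    show "x b' r \<in> {0, 1}" for b' r
      by (simp add: x_def)
    show "(\<Sum>r\<in>routes. \<Sum>b'\<in>{b' \<in> groups. m \<in> b'}. x b' r) \<le> 1" for m
    proof -
      have "real (\<Sum>r\<in>routes. \<Sum>b'\<in>{b' \<in> groups. m \<in> b'}. x b' r) = real (card {j. j < n \<and> m \<in> b j})"
        using rider_sum [of "\<lambda>_ _. 1" m] by simp
      then have "(\<Sum>r\<in>routes. \<Sum>b'\<in>{b' \<in> groups. m \<in> b'}. x b' r) = card {j. j < n \<and> m \<in> b j}"
        by (simp only: of_nat_eq_iff)
      also have "\<dots> \<le> 1"
        using disjoint by (auto simp: card_le_Suc0_iff_eq)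
      finally show ?thesis .
    qed
    show "edge_load x e \<le> q e" if "e \<in> arcs G" for e
    proof -
      have "edge_load x e \<le> route_load rs e"
        unfolding load load_full by (intro card_mono) auto
      also have "\<dots> \<le> q e"
        using flow that by (simp add: supporting_flow_def)
      finally show ?thesis .
    qed
  qed
  moreover have "individually_rational x p"
    using u_nonneg by (simp add: individually_rational_def utility)
  moreover have "stable x p \<tau>"
    unfolding stable_def utility
  proof (intro ballI)
    fix b' r assume "b' \<in> groups" "r \<in> routes"
    then show "trip_value b' r - sum \<tau> (set r) \<le> (\<Sum>m\<in>b'. u m)"
      using trip_value [of b' r] profit_le [of b' "route_time r"] \<Lambda>_le [of r] by simp
  qed
  moreover have "budget_balanced x p \<tau>"
    unfolding budget_balanced_def
  proof (intro conjI ballI impI)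
    fix b' r assume "b' \<in> groups" "r \<in> routes" "x b' r = 1"
    then obtain j where j: "j < n" "rs ! j = r" "b j = b'"
      by (auto simp: x_def of_bool_def split: if_splits)
    have "(\<Sum>m\<in>b'. p m) = (\<Sum>m\<in>b'. rider_value m b' r - u m)"
      using slots_of [OF j(1)] j by (intro sum.cong) (simp_all add: p_def rider_sum)
    also have "\<dots> = trip_value b' r + trip_cost b' r - (\<Sum>m\<in>b'. u m)"
      by (simp add: trip_value_def sum_subtractf)
    also have "\<dots> = sum \<tau> (set r) + trip_cost b' r"
      using trip_value [OF \<open>b' \<in> groups\<close>, of r] profit_slot [OF j(1)] \<Lambda>_slot [OF j(1)] j
      by (simp add: T_def)
    finally show "(\<Sum>m\<in>b'. p m) = sum \<tau> (set r) + trip_cost b' r" .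
  next
    fix m assume m: "m \<in> M" "\<forall>r\<in>routes. \<forall>b'\<in>groups. m \<in> b' \<longrightarrow> x b' r = 0"
    have "m \<notin> b j" if "j < n" for j
    proof
      assume "m \<in> b j"
      then have "x (b j) (rs ! j) = 0"
        using m(2) rs_routes [OF that] slot_groups [OF that] by blast
      then show False
        using that by (auto simp: x_def)
    qed
    then have "u m = 0"
      using u_unmatched m(1) by blast
    then show "p m = 0"
      using m(2) by (simp add: p_def)
  qed
  moreover have "market_clearing x \<tau>"
    unfolding market_clearing_def
  proof (intro ballI impI)
    fix e assume e: "e \<in> arcs G" "edge_load x e < q e"
    show "\<tau> e = 0"
    \<comment> \<open>An empty slot through \<open>e\<close> has maximal profit 0, so every toll on
      its route is 0. Otherwise all slots through \<open>e\<close> are occupied, and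
      \<open>e\<close> is unsaturated by the flow itself.\<close>
    proof (cases "\<exists>j<n. e \<in> set (rs ! j) \<and> b j = {}")
      case True
      then obtain j where j: "j < n" "e \<in> set (rs ! j)" "b j = {}"
        by blast
      then have "sum \<tau> (set (rs ! j)) = 0"
        using \<Lambda>_slot [OF j(1)] profit_slot [OF j(1)] profit_empty by simp
      then show ?thesis
        using j(2) \<tau>_nonneg by (simp add: sum_nonneg_eq_0_iff)
    next
      case False
      then have "{j. j < n \<and> e \<in> set (rs ! j) \<and> b j \<noteq> {}} = {j. j < n \<and> e \<in> set (rs ! j)}"
        by blast
      then show ?thesis
        using tolls e by (simp add: load load_full)
    qed
  qed
  ultimately show ?thesis
    using \<tau>_nonneg unfolding market_equilibrium_def is_outcome_def by blast
qed

end

theorem theorem2: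
  fixes G :: "('v, 'e) pre_digraph"
    and orig dest :: 'v
    and q :: "'e \<Rightarrow> nat"
    and t :: "'e \<Rightarrow> real"
    and M :: "'m set"
    and A :: nat
    and \<alpha> \<beta> :: "'m \<Rightarrow> real"
    and \<gamma> :: "'m \<Rightarrow> nat \<Rightarrow> real"
    and \<delta> :: real
    and \<gamma>\<^sub>0 :: "nat \<Rightarrow> real"
  assumes "carpool_market G orig dest q t M A \<beta> \<gamma> \<delta>"
    and "series_parallel G orig dest"
    and "\<forall>m\<in>M. \<forall>d\<in>{1..A}. \<gamma> m d = \<gamma>\<^sub>0 d"
  shows "\<exists>x p \<tau>. carpool_market.market_equilibrium G orig dest q t M A \<alpha> \<beta> \<gamma> \<delta> x p \<tau>"
proof -
  interpret carpool_market G orig dest q t M A \<alpha> \<beta> \<gamma> \<delta>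
    by fact
  show ?thesis
  \<comment> \<open>Without riders nothing is known about the disutilities, and the zero function
    serves as \<open>g\<close>. Otherwise the parameters of any one rider do.\<close>
  proof (cases "M = {}")
    case True
    then show ?thesis
      using market_equilibrium_exists [OF assms(2), of "\<lambda>_. 0"] by (simp add: monotone_on_def)
  next
    case False
    then obtain m where m: "m \<in> M" by blast
    show ?thesis
    proof (rule market_equilibrium_exists [OF assms(2), of "\<gamma> m"])
      show "\<gamma> m' d = \<gamma> m d" if "m' \<in> M" "d \<in> {1..A}" for m' d
        using assms(3) m that by simp
      show "0 \<le> \<gamma> m 2" if "2 \<le> A"
        using gamma_nonneg [OF m, of 2] that by simp
    qed (use m gamma_one gamma_increments_mono in auto)
  qed
qed

end
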